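(* For every integer $n\geq 2$, $$\frac{n+1}{2^{n+1}}\,T_n < R_n < \frac12\, T_n,$$ and therefore $$n^2-\frac{10n^2}{\ln n}-n+\log_2(n+1)-1 < \log_2 R_n < n^2-1,$$ so $\log_2 R_n\sim n^2$ as $n\to\infty$.
   Context: The chambers of a finite arrangement of linear hyperplanes in a finite-dimensional real vector space $V$ are the connected components of the complement in $V$ of the union of the hyperplanes. Threshold arrangement: $\mathcal{T}_{n+1}$ is the arrangement in $\mathbb{R}^{n+1}$ of the $2^n$ distinct hyperplanes through the origin whose normal vectors are the vectors in $\{-1,1\}^{n+1}$ (opposite vectors give the same hyperplane). $T_n$ is the number of chambers of $\mathcal{T}_{n+1}$; equivalently (well known) $T_n$ is the number of linear threshold functions $f:\{-1,1\}^n\to\{-1,1\}$, $f(\mathbf{x})=\operatorname{sgn}(t+\mathbf{a}\cdot\mathbf{x})$ with $t\in\mathbb{R}$, $\mathbf{a}\in\mathbb{R}^n$. Resonance arrangement: let $V_\emptyset=\{\mathbf{x}\in\mathbb{R}^{n+1}:\sum_i x_i=0\}$. $\mathcal{R}_n$ is the arrangement in the vector space $V_\emptyset$ of the hyperplanes $\{\mathbf{x}\in V_\emptyset:\sum_{i\in S}x_i=0\}$ for $\emptyset\neq S\subsetneq\{1,\dots,n+1\}$. $R_n$ is the number of chambers of $\mathcal{R}_n$. $a_n\sim b_n$ means $a_n/b_n\to1$. *)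

theory Defs
  imports "HOL-Analysis.Analysis"
begin

text \<open>
  The dimension varies within the statement, so real coordinate space of dimension \<open>d\<close> is the
  library space \<open>Euclidean_space d\<close>: its points are the functions \<open>nat \<Rightarrow> real\<close> vanishing outside
  \<open>{..<d}\<close>, with the product topology.  Coordinates are numbered from 0, so the index set
  \<open>{1,...,n+1}\<close> becomes \<open>{..n}\<close>.
\<close>

text \<open>
  An arrangement is a set of hyperplanes, each given as a set of points; hence different normal
  vectors of one hyperplane contribute a single element.
\<close>

definition chambers :: "'a topology \<Rightarrow> 'a set set \<Rightarrow> 'a set set" where
  "chambers V \<A> = connected_components_of (subtopology V (topspace V - \<Union>\<A>))"

definition threshold_arrangement :: "nat \<Rightarrow> (nat \<Rightarrow> real) set set" where
  "threshold_arrangement d =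
     {{x \<in> topspace (Euclidean_space d). (\<Sum>i<d. v i * x i) = 0} | v. \<forall>i<d. v i \<in> {-1, 1}}"

definition T :: "nat \<Rightarrow> nat" where
  "T n = card (chambers (Euclidean_space (n + 1)) (threshold_arrangement (n + 1)))"

definition zero_sum_space :: "nat \<Rightarrow> (nat \<Rightarrow> real) topology" where
  "zero_sum_space n = subtopology (Euclidean_space (n + 1)) {x. (\<Sum>i\<le>n. x i) = 0}"

definition resonance_arrangement :: "nat \<Rightarrow> (nat \<Rightarrow> real) set set" where
  "resonance_arrangement n =
     {{x \<in> topspace (zero_sum_space n). (\<Sum>i\<in>S. x i) = 0} | S. S \<noteq> {} \<and> S \<subset> {..n}}"

definition R :: "nat \<Rightarrow> nat" where
  "R n = card (chambers (zero_sum_space n) (resonance_arrangement n))"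

end

theory Submission
  imports Defs "HOL-Real_Asymp.Real_Asymp"
begin

text \<open>
  Chambers correspond to the sign patterns of the linear forms.  The resonance arrangement is the
  restriction of the threshold arrangement to the hyperplane normal to the all-ones vector, and by
  symmetry every restriction has \<open>R n\<close> chambers.  Counting the pairs of a chamber and one of its walls
  gives \<open>2\<^sup>n\<^sup>+\<^sup>1 R n\<close> pairs; every chamber has at least \<open>n + 1\<close> walls and one has \<open>2\<^sup>n\<close>, which is the
  lower bound.  The upper bound holds because every chamber of the restriction lies between two
  chambers, and some chamber does not touch the hyperplane.

  The number of sign patterns lies between the number of strongly shattered and the number of
  shattered sets of normals.  Shattered sets are linearly independent, and counting small sets of
  normals gives \<open>T n \<le> 2 ^ n\<^sup>2\<close>.  Independent sets whose span contains no further normal are strongly shattered.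
  Following Odlyzko, almost all \<open>p\<close>-sets of normals are of this kind for \<open>p\<close> about \<open>n - 9 n / ln n\<close>:
  otherwise \<open>k \<ge> 3\<close> normals satisfy a relation with nonzero coefficients \<open>c\<close>; then \<open>k - 1\<close> columns of the
  matrix of these normals confine the others to a subspace of the orthogonal complement of \<open>c\<close>,
  which contains few sign vectors by Littlewood-Offord.
\<close>

subsection \<open>Linear algebra on real functions\<close>

text \<open>The lower bound on \<open>T n\<close> is governed by a factor \<open>2 ^ n\<close> in a
  union bound. A p-tuple is bad when some j of its members and one further normal satisfy a relation
  with nonzero coefficients, and that normal can be any of \<open>2 ^ n\<close>. The bound sums
  terms \<open>(p choose j) * (n choose j) * 2 ^ n * b ^ (n - j)\<close>, with b the
  Littlewood-Offord probability for j + 1 signs. For small j this needs b < 1/2. Three or four signs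
  give 3/8, whereas two give exactly 1/2; relations of two terms do not occur between distinct
  normals. For j close to n, b is about \<open>1 / sqrt j\<close> while the other factors can reach
  \<open>2 ^ (3 * n)\<close>, so n - j must stay of order \<open>n / ln n\<close>. Hence p = n - r
  with r about \<open>9 * n / ln n\<close>.

  Half of the \<open>(2 ^ n) ^ p\<close> tuples then yield at least
  \<open>2 ^ (n * p - 1) / p ^ p\<close> sets. In the logarithm r costs
  \<open>9 * n^2 / ln n\<close>, and rounding, the halving and \<open>p ^ p\<close> together fit
  into one more \<open>n^2 / ln n\<close>: this is the constant 10.\<close>

definition dot :: "'i set \<Rightarrow> ('i \<Rightarrow> real) \<Rightarrow> ('i \<Rightarrow> real) \<Rightarrow> real" where
  "dot I u x = (\<Sum>i\<in>I. u i * x i)"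

lemma dot_combine_right: "dot I u (\<lambda>i. a * x i + b * y i) = a * dot I u x + b * dot I u y"
  by (simp add: dot_def sum.distrib sum_distrib_left algebra_simps)

lemma dot_combine_left: "dot I (\<lambda>i. a * x i + b * y i) u = a * dot I x u + b * dot I y u"
  by (simp add: dot_def sum.distrib sum_distrib_left algebra_simps)

lemma dot_add_right: "dot I u (\<lambda>i. x i + e * y i) = dot I u x + e * dot I u y"
  using dot_combine_right[of I u 1 x e y] by simp

lemma dot_scale_left: "dot I (\<lambda>i. a * x i) u = a * dot I x u"
  using dot_combine_left[of I a x 0 x u] by simp

lemma dot_sum_right: "dot I u (\<lambda>i. \<Sum>j\<in>J. c j * y j i) = (\<Sum>j\<in>J. c j * dot I u (y j))"
  unfolding dot_def sum_distrib_left by (subst sum.swap) (simp add: algebra_simps)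

lemma dot_sum_left: "dot I (\<lambda>i. \<Sum>j\<in>J. c j * y j i) u = (\<Sum>j\<in>J. c j * dot I (y j) u)"
  unfolding dot_def sum_distrib_left sum_distrib_right by (subst sum.swap) (simp add: algebra_simps)

lemma dot_self_pos: "finite I \<Longrightarrow> i \<in> I \<Longrightarrow> u i \<noteq> 0 \<Longrightarrow> dot I u u > 0"
  unfolding dot_def by (rule sum_pos2[of _ i]) (auto simp: zero_less_mult_iff)

lemma dot_cong_left: "(\<And>i. i \<in> I \<Longrightarrow> u i = v i) \<Longrightarrow> dot I u x = dot I v x"
  by (simp add: dot_def)

text \<open>Gaussian elimination, one equation at a time: a pivot \<open>w k a\<close> removes
  coordinate \<open>a\<close> from the other equations, and back substitution recovers its value.
  The unknowns are sometimes coordinates and sometimes coefficients of a family of vectors, hence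
  the arbitrary index set.\<close>

lemma homogeneous_system:
  assumes "finite J" "finite I" "card J < card I"
  shows "\<exists>d. (\<exists>i\<in>I. d i \<noteq> 0) \<and> (\<forall>j\<in>J. dot I (w j) d = 0)"
  using assms
proof (induction J arbitrary: I w rule: finite_induct)
  case empty
  then have "I \<noteq> {}" by auto
  then show ?case by (intro exI[of _ "\<lambda>_. 1"]) auto
next
  case (insert k J)
  show ?case
  proof (cases "\<forall>i\<in>I. w k i = 0")
    case True
    obtain d where "\<exists>i\<in>I. d i \<noteq> 0" "\<forall>j\<in>J. dot I (w j) d = 0"
      using insert.IH[of I w] insert.prems insert.hyps by auto
    moreover have "dot I (w k) d = 0" using True by (simp add: dot_def)
    ultimately show ?thesis by auto
  next
    case False
    then obtain a where a: "a \<in> I" "w k a \<noteq> 0" by auto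
    define v where "v j i = w j i - w j a / w k a * w k i" for j i
    have "card J < card (I - {a})" using insert.prems insert.hyps a by simp
    then obtain d where d: "\<exists>i\<in>I-{a}. d i \<noteq> 0" "\<forall>j\<in>J. dot (I-{a}) (v j) d = 0"
      using insert.IH[of "I - {a}" v] insert.prems by auto
    define e where "e = d(a := - dot (I-{a}) (w k) d / w k a)"
    have split: "dot I u e = u a * e a + dot (I-{a}) u d" for u
      unfolding dot_def using insert.prems a
      by (subst sum.remove[of I a]) (auto simp: e_def intro!: sum.cong)
    have k: "dot I (w k) e = 0" unfolding split using a by (simp add: e_def)
    have "dot I (w j) e = 0" if "j \<in> J" for j
    proof -
      have "dot (I-{a}) (w j) d = dot (I-{a}) (\<lambda>i. 1 * v j i + (w j a / w k a) * w k i) d"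
        by (simp add: v_def)
      also have "\<dots> = (w j a / w k a) * dot (I-{a}) (w k) d"
        unfolding dot_combine_left using d that by simp
      finally show ?thesis unfolding split using a by (simp add: e_def)
    qed
    moreover have "\<exists>i\<in>I. e i \<noteq> 0" using d by (auto simp: e_def)
    ultimately show ?thesis using k by auto
  qed
qed

text \<open>A finite-dimensional span is its own double annihilator. In the essential case some
  \<open>y\<close> detects \<open>w k\<close>: first a multiple of \<open>w k\<close> is taken off
  \<open>v\<close> to make it vanish at \<open>y\<close>, then a multiple of \<open>y\<close> is
  taken off the solution for the new \<open>v'\<close> to make \<open>w k\<close> vanish. The second
  correction does not change the value of \<open>v'\<close>.\<close>

lemma exists_annihilator_off_span:
  assumes "finite J" "finite I"
    and "\<nexists>c. \<forall>i\<in>I. v i = (\<Sum>j\<in>J. c j * w j i)"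
  shows "\<exists>x. (\<forall>j\<in>J. dot I (w j) x = 0) \<and> dot I v x \<noteq> 0"
  using assms(1,3)
proof (induction J arbitrary: v rule: finite_induct)
  case empty
  then obtain i where i: "i \<in> I" "v i \<noteq> 0" by auto
  show ?case using dot_self_pos[of I i v, OF assms(2) i] by (intro exI[of _ v]) auto
next
  case (insert k J)
  show ?case
  proof (cases "\<exists>c. \<forall>i\<in>I. w k i = (\<Sum>j\<in>J. c j * w j i)")
    case True
    then obtain c where c: "\<forall>i\<in>I. w k i = (\<Sum>j\<in>J. c j * w j i)" by auto
    have "\<nexists>c'. \<forall>i\<in>I. v i = (\<Sum>j\<in>J. c' j * w j i)"
    proof
      assume "\<exists>c'. \<forall>i\<in>I. v i = (\<Sum>j\<in>J. c' j * w j i)"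
      then obtain c' where c': "\<forall>i\<in>I. v i = (\<Sum>j\<in>J. c' j * w j i)" by auto
      have "\<forall>i\<in>I. v i = (\<Sum>j\<in>insert k J. (c'(k := 0)) j * w j i)"
        using c' insert.hyps by (auto intro!: sum.cong)
      then show False using insert.prems by blast
    qed
    then obtain x where x: "\<forall>j\<in>J. dot I (w j) x = 0" "dot I v x \<noteq> 0" using insert.IH[of v] by blast
    have "dot I (w k) x = dot I (\<lambda>i. \<Sum>j\<in>J. c j * w j i) x" by (rule dot_cong_left) (use c in auto)
    also have "\<dots> = 0" unfolding dot_sum_left using x by simp
    finally show ?thesis using x by auto
  next
    case False
    then obtain y where y: "\<forall>j\<in>J. dot I (w j) y = 0" "dot I (w k) y \<noteq> 0"
      using insert.IH[of "w k"] by auto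
    define q where "q = dot I v y / dot I (w k) y"
    define v' where "v' i = 1 * v i + (- q) * w k i" for i
    have "\<nexists>c. \<forall>i\<in>I. v' i = (\<Sum>j\<in>J. c j * w j i)"
    proof
      assume "\<exists>c. \<forall>i\<in>I. v' i = (\<Sum>j\<in>J. c j * w j i)"
      then obtain c where c: "\<forall>i\<in>I. v' i = (\<Sum>j\<in>J. c j * w j i)" by auto
      have "\<forall>i\<in>I. v i = (\<Sum>j\<in>insert k J. (c(k := q)) j * w j i)"
      proof
        fix i assume i: "i \<in> I"
        have "(\<Sum>j\<in>J. (c(k := q)) j * w j i) = (\<Sum>j\<in>J. c j * w j i)"
          using insert.hyps by (intro sum.cong) auto
        then show "v i = (\<Sum>j\<in>insert k J. (c(k := q)) j * w j i)"
          using c i insert.hyps by (auto simp: v'_def)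
      qed
      then show False using insert.prems by blast
    qed
    then obtain x where x: "\<forall>j\<in>J. dot I (w j) x = 0" "dot I v' x \<noteq> 0"
      using insert.IH[of v'] by auto
    define p where "p = dot I (w k) x / dot I (w k) y"
    define z where "z i = x i + (- p) * y i" for i
    have z: "dot I u z = dot I u x - p * dot I u y" for u
      unfolding z_def dot_add_right by simp
    have v': "dot I v' x = dot I v x - q * dot I (w k) x"
      unfolding v'_def dot_combine_left by simp
    have "\<forall>j\<in>insert k J. dot I (w j) z = 0" using x y by (auto simp: z p_def)
    moreover have "dot I v z = dot I v' x" using y by (simp add: z v' p_def q_def)
    ultimately show ?thesis using x by (intro exI[of _ z]) auto
  qed
qed

lemma perturbation_keeps_signs:
  assumes "finite B"
  shows "\<exists>e>0. \<forall>b\<in>B. dot I b x \<noteq> 0 \<longrightarrow> sgn (dot I b (\<lambda>i. x i + e * d i)) = sgn (dot I b x)"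
proof -
  have "\<forall>\<^sub>F e in at_right (0::real). sgn (s + e * t) = sgn s" if "s \<noteq> 0" for s t :: real
  proof -
    have lim: "((\<lambda>e. s + e * t) \<longlongrightarrow> s + 0 * t) (at_right 0)" by (intro tendsto_intros)
    show ?thesis
    proof (cases "s > 0")
      case True
      then have "\<forall>\<^sub>F e in at_right 0. s + e * t > 0" using order_tendstoD(1)[OF lim, of 0] by simp
      then show ?thesis by eventually_elim (use True in simp)
    next
      case False
      then have "\<forall>\<^sub>F e in at_right 0. s + e * t < 0" using order_tendstoD(2)[OF lim, of 0] that by simp
      then show ?thesis by eventually_elim (use False that in simp)
    qed
  qed
  then have "\<forall>b\<in>B. \<forall>\<^sub>F e in at_right 0. dot I b x \<noteq> 0 \<longrightarrow> sgn (dot I b x + e * dot I b d) = sgn (dot I b x)"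
    by (auto intro: always_eventually)
  then have "\<forall>\<^sub>F e in at_right 0. \<forall>b\<in>B. dot I b x \<noteq> 0 \<longrightarrow> sgn (dot I b x + e * dot I b d) = sgn (dot I b x)"
    by (rule eventually_ball_finite[OF assms])
  then have "\<forall>\<^sub>F e in at_right 0. e > 0 \<and> (\<forall>b\<in>B. dot I b x \<noteq> 0 \<longrightarrow> sgn (dot I b x + e * dot I b d) = sgn (dot I b x))"
    using eventually_at_right_less[of "0::real"] by eventually_elim auto
  from eventually_happens'[OF _ this] show ?thesis unfolding dot_add_right by auto
qed

text \<open>Finitely many proper hyperplanes do not cover \<open>U\<close>. The forms are treated
  one by one, each time moving along a vector on which the form does not vanish, by so little that
  no nonzero sign changes. Closure of \<open>U\<close> under \<open>y + e z\<close> covers both the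
  whole space and a linear subspace.\<close>

lemma generic_perturbation:
  assumes "finite B" and "x \<in> U"
    and U: "\<And>y z e. y \<in> U \<Longrightarrow> z \<in> U \<Longrightarrow> (\<lambda>i. y i + e * z i) \<in> U"
    and B: "\<And>b. b \<in> B \<Longrightarrow> \<exists>z\<in>U. dot I b z \<noteq> 0"
  shows "\<exists>y\<in>U. \<forall>b\<in>B. dot I b y \<noteq> 0 \<and> (dot I b x \<noteq> 0 \<longrightarrow> sgn (dot I b y) = sgn (dot I b x))"
proof -
  have "\<exists>y\<in>U. (\<forall>b\<in>C. dot I b y \<noteq> 0) \<and> (\<forall>b\<in>B. dot I b x \<noteq> 0 \<longrightarrow> sgn (dot I b y) = sgn (dot I b x))"
    if "C \<subseteq> B" for C
    using finite_subset[OF that assms(1)] that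
  proof (induction C rule: finite_induct)
    case empty
    then show ?case using assms(2) by auto
  next
    case (insert c C)
    then obtain y where y: "y \<in> U" "\<forall>b\<in>C. dot I b y \<noteq> 0"
      "\<forall>b\<in>B. dot I b x \<noteq> 0 \<longrightarrow> sgn (dot I b y) = sgn (dot I b x)" by auto
    show ?case
    proof (cases "dot I c y = 0")
      case False
      then show ?thesis using y by auto
    next
      case True
      obtain z where z: "z \<in> U" "dot I c z \<noteq> 0" using B[of c] insert.prems by auto
      obtain e where e: "e > 0"
        "\<forall>b\<in>B. dot I b y \<noteq> 0 \<longrightarrow> sgn (dot I b (\<lambda>i. y i + e * z i)) = sgn (dot I b y)"
        using perturbation_keeps_signs[OF assms(1)] by blast
      have "dot I c (\<lambda>i. y i + e * z i) \<noteq> 0" using True z e by (simp add: dot_add_right)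
      moreover have "dot I b (\<lambda>i. y i + e * z i) \<noteq> 0" if "b \<in> C" for b
        using that y e insert.prems by (metis insert_subset sgn_eq_0_iff subset_iff)
      moreover have "sgn (dot I b (\<lambda>i. y i + e * z i)) = sgn (dot I b x)"
        if "b \<in> B" "dot I b x \<noteq> 0" for b
        using that y e by (metis sgn_eq_0_iff)
      ultimately show ?thesis using U[OF y(1) z(1), of e] by (intro bexI[of _ "\<lambda>i. y i + e * z i"]) auto
    qed
  qed
  from this[of B] show ?thesis by auto
qed

subsection \<open>Sign patterns and walls\<close>

definition sign_pattern :: "'i set \<Rightarrow> 'a set \<Rightarrow> ('a \<Rightarrow> 'i \<Rightarrow> real) \<Rightarrow> ('i \<Rightarrow> real) \<Rightarrow> 'a set" where
  "sign_pattern I A w x = {a \<in> A. dot I (w a) x > 0}"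

definition sign_patterns :: "'i set \<Rightarrow> 'a set \<Rightarrow> ('a \<Rightarrow> 'i \<Rightarrow> real) \<Rightarrow> 'a set set" where
  "sign_patterns I A w = {sign_pattern I A w x | x. \<forall>a\<in>A. dot I (w a) x \<noteq> 0}"

text \<open>These are the chambers of the restriction to the hyperplane of \<open>h\<close>. Leaving
  \<open>h\<close> out makes a pattern \<open>P\<close> directly comparable with the two chambers on
  either side, \<open>P\<close> and \<open>insert h P\<close>.\<close>

definition restricted_patterns :: "'i set \<Rightarrow> 'a set \<Rightarrow> ('a \<Rightarrow> 'i \<Rightarrow> real) \<Rightarrow> 'a \<Rightarrow> 'a set set" where
  "restricted_patterns I A w h =
     {sign_pattern I (A - {h}) w x | x. dot I (w h) x = 0 \<and> (\<forall>a\<in>A-{h}. dot I (w a) x \<noteq> 0)}"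

text \<open>Crossing the hyperplane of \<open>h\<close>. That \<open>flip h P\<close> is again a
  pattern serves as the definition of \<open>h\<close> being a wall of the chamber
  \<open>P\<close>.\<close>

definition flip :: "'a \<Rightarrow> 'a set \<Rightarrow> 'a set" where
  "flip h P = (if h \<in> P then P - {h} else insert h P)"

lemma mem_flip_iff: "a \<in> flip h P \<longleftrightarrow> (if a = h then a \<notin> P else a \<in> P)"
  by (auto simp: flip_def)

lemma sign_patternsI:
  "(\<And>a. a \<in> A \<Longrightarrow> dot I (w a) x \<noteq> 0) \<Longrightarrow> P \<subseteq> A \<Longrightarrow>
   (\<And>a. a \<in> A \<Longrightarrow> dot I (w a) x > 0 \<longleftrightarrow> a \<in> P) \<Longrightarrow> P \<in> sign_patterns I A w"
  unfolding sign_patterns_def sign_pattern_def by blast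

lemma sign_patternsE:
  assumes "P \<in> sign_patterns I A w"
  obtains x where "P \<subseteq> A" "\<And>a. a \<in> P \<Longrightarrow> dot I (w a) x > 0" "\<And>a. a \<in> A - P \<Longrightarrow> dot I (w a) x < 0"
proof -
  from assms obtain x where x: "\<forall>a\<in>A. dot I (w a) x \<noteq> 0" "P = {a \<in> A. dot I (w a) x > 0}"
    unfolding sign_patterns_def sign_pattern_def by blast
  show ?thesis by (rule that[of x]) (use x in \<open>auto simp: linorder_neq_iff\<close>)
qed

lemma sign_patterns_subset_Pow: "sign_patterns I A w \<subseteq> Pow A"
  unfolding sign_patterns_def sign_pattern_def by blast

lemma finite_sign_patterns: "finite A \<Longrightarrow> finite (sign_patterns I A w)"
  by (rule finite_subset[OF sign_patterns_subset_Pow]) simp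

text \<open>Leave the hyperplane in either direction; conversely, cut it with a segment joining the two
  chambers.\<close>

lemma restricted_patterns_eq:
  assumes "finite A" "finite I" "h \<in> A" and h: "\<exists>i\<in>I. w h i \<noteq> 0"
  shows "restricted_patterns I A w h =
    {P. P \<subseteq> A - {h} \<and> P \<in> sign_patterns I A w \<and> insert h P \<in> sign_patterns I A w}"
proof (intro equalityI subsetI)
  fix P assume "P \<in> restricted_patterns I A w h"
  then obtain x where x: "P = {a \<in> A - {h}. dot I (w a) x > 0}" "dot I (w h) x = 0"
    "\<forall>a\<in>A-{h}. dot I (w a) x \<noteq> 0"
    unfolding restricted_patterns_def sign_pattern_def by blast
  have PA: "P \<subseteq> A" unfolding x(1) by blast
  obtain i where "i \<in> I" "w h i \<noteq> 0" using h by auto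
  from dot_self_pos[of I i "w h", OF assms(2) this] have pos: "dot I (w h) (w h) > 0" .
  have *: "\<exists>e>0. \<forall>b\<in>w ` A. dot I b x \<noteq> 0 \<longrightarrow> sgn (dot I b (\<lambda>i. x i + e * d i)) = sgn (dot I b x)" for d
    using assms by (intro perturbation_keeps_signs) auto
  obtain e where e: "e > 0" "\<forall>b\<in>w ` A. dot I b x \<noteq> 0 \<longrightarrow>
      sgn (dot I b (\<lambda>i. x i + e * w h i)) = sgn (dot I b x)"
    using *[of "w h"] by auto
  define y where "y = (\<lambda>i. x i + e * w h i)"
  have y: "dot I (w h) y > 0" using pos x e by (simp add: y_def dot_add_right)
  have ya: "dot I (w a) y \<noteq> 0 \<and> (dot I (w a) y > 0 \<longleftrightarrow> dot I (w a) x > 0)" if "a \<in> A - {h}" for a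
    using e(2) x(3) that unfolding y_def[symmetric]
    by (metis Diff_iff imageI sgn_0_0 sgn_greater)
  have 1: "insert h P \<in> sign_patterns I A w"
  proof (rule sign_patternsI[of _ _ _ y])
    fix a assume a: "a \<in> A"
    have "dot I (w a) y \<noteq> 0 \<and> (0 < dot I (w a) y \<longleftrightarrow> a \<in> insert h P)"
    proof (cases "a = h")
      case True
      then show ?thesis using y x(1) by simp
    next
      case False
      then show ?thesis using ya[of a] a by (simp add: x(1))
    qed
    then show "dot I (w a) y \<noteq> 0" "0 < dot I (w a) y \<longleftrightarrow> a \<in> insert h P" by blast+
  qed (simp add: PA assms(3))
  obtain e where e: "e > 0" "\<forall>b\<in>w ` A. dot I b x \<noteq> 0 \<longrightarrow>
      sgn (dot I b (\<lambda>i. x i + e * (- w h i))) = sgn (dot I b x)"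
    using *[of "\<lambda>i. - w h i"] by auto
  define y where "y = (\<lambda>i. x i + e * (- w h i))"
  have "dot I (w h) y = - e * dot I (w h) (w h)"
    using x(2) dot_add_right[of I "w h" x "-e" "w h"] by (simp add: y_def)
  then have y: "dot I (w h) y < 0" using pos e by simp
  have ya: "dot I (w a) y \<noteq> 0 \<and> (dot I (w a) y > 0 \<longleftrightarrow> dot I (w a) x > 0)" if "a \<in> A - {h}" for a
    using e(2) x(3) that unfolding y_def[symmetric]
    by (metis Diff_iff imageI sgn_0_0 sgn_greater)
  have 2: "P \<in> sign_patterns I A w"
  proof (rule sign_patternsI[of _ _ _ y])
    fix a assume a: "a \<in> A"
    have "dot I (w a) y \<noteq> 0 \<and> (0 < dot I (w a) y \<longleftrightarrow> a \<in> P)"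
    proof (cases "a = h")
      case True
      then show ?thesis using y x(1) by simp
    next
      case False
      then show ?thesis using ya[of a] a by (simp add: x(1))
    qed
    then show "dot I (w a) y \<noteq> 0" "0 < dot I (w a) y \<longleftrightarrow> a \<in> P" by blast+
  qed (rule PA)
  have 3: "P \<subseteq> A - {h}" unfolding x(1) by blast
  show "P \<in> {P. P \<subseteq> A - {h} \<and> P \<in> sign_patterns I A w \<and> insert h P \<in> sign_patterns I A w}"
    using 1 2 3 by blast
next
  fix P assume "P \<in> {P. P \<subseteq> A - {h} \<and> P \<in> sign_patterns I A w \<and> insert h P \<in> sign_patterns I A w}"
  then have P: "P \<subseteq> A - {h}" "P \<in> sign_patterns I A w" "insert h P \<in> sign_patterns I A w" by auto
  obtain x where x: "\<And>a. a \<in> P \<Longrightarrow> dot I (w a) x > 0" "\<And>a. a \<in> A - P \<Longrightarrow> dot I (w a) x < 0"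
    using P(2) by (elim sign_patternsE) auto
  obtain y where y: "\<And>a. a \<in> insert h P \<Longrightarrow> dot I (w a) y > 0"
     "\<And>a. a \<in> A - insert h P \<Longrightarrow> dot I (w a) y < 0"
    using P(3) by (elim sign_patternsE) auto
  have xh: "dot I (w h) x < 0" using x(2)[of h] P assms by auto
  have yh: "dot I (w h) y > 0" using y(1) by auto
  \<comment> \<open>Up to a positive factor, the point where the segment from \<open>x\<close> to
    \<open>y\<close> meets the hyperplane. Both coefficients are positive, so every sign shared by
    \<open>x\<close> and \<open>y\<close> persists.\<close>
  define z where "z = (\<lambda>i. dot I (w h) y * x i + (- dot I (w h) x) * y i)"
  have z: "dot I u z = dot I (w h) y * dot I u x + (- dot I (w h) x) * dot I u y" for u
    unfolding z_def dot_combine_right ..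
  have zh: "dot I (w h) z = 0" by (simp add: z)
  have zp: "dot I (w a) z > 0" if "a \<in> P" for a
    unfolding z using x(1)[of a] y(1)[of a] that xh yh
    by (intro add_pos_pos mult_pos_pos) auto
  have zn: "dot I (w a) z < 0" if "a \<in> A - insert h P" for a
    unfolding z using x(2)[of a] y(2)[of a] that xh yh
    by (intro add_neg_neg mult_pos_neg) auto
  have ne: "\<forall>a\<in>A-{h}. dot I (w a) z \<noteq> 0"
    using zp zn by (metis Diff_iff insert_iff less_irrefl)
  have "P = {a \<in> A - {h}. dot I (w a) z > 0}"
  proof (intro equalityI subsetI)
    fix a assume "a \<in> P"
    then show "a \<in> {a \<in> A - {h}. dot I (w a) z > 0}" using P(1) zp[of a] by auto
  next
    fix a assume "a \<in> {a \<in> A - {h}. dot I (w a) z > 0}"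
    then show "a \<in> P" using zn[of a] by (cases "a \<in> P") auto
  qed
  then show "P \<in> restricted_patterns I A w h"
    unfolding restricted_patterns_def sign_pattern_def using zh ne by blast
qed

text \<open>Each chamber of the restriction is counted twice, once from either side.\<close>

lemma card_flippable:
  assumes "finite A" "finite I" "h \<in> A" "\<exists>i\<in>I. w h i \<noteq> 0"
  shows "card {P \<in> sign_patterns I A w. flip h P \<in> sign_patterns I A w}
       = 2 * card (restricted_patterns I A w h)"
proof -
  let ?R = "restricted_patterns I A w h"
  note R = restricted_patterns_eq[of A I h w, OF assms]
  have fin: "finite ?R" unfolding R by (rule finite_subset[of _ "Pow A"]) (use assms in auto)
  have "{P \<in> sign_patterns I A w. flip h P \<in> sign_patterns I A w} = ?R \<union> insert h ` ?R"
  proof (intro equalityI subsetI)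
    fix P assume P: "P \<in> {P \<in> sign_patterns I A w. flip h P \<in> sign_patterns I A w}"
    then have "P \<subseteq> A" using sign_patterns_subset_Pow[of I A w] by (simp add: subset_iff) blast
    show "P \<in> ?R \<union> insert h ` ?R"
    proof (cases "h \<in> P")
      case True
      then have "P - {h} \<in> ?R" "P = insert h (P - {h})"
        unfolding R using P \<open>P \<subseteq> A\<close> by (auto simp: flip_def insert_absorb)
      then show ?thesis by blast
    next
      case False
      then show ?thesis unfolding R using P \<open>P \<subseteq> A\<close> by (auto simp: flip_def)
    qed
  next
    fix P assume "P \<in> ?R \<union> insert h ` ?R"
    then obtain Q where Q: "Q \<in> ?R" "P = Q \<or> P = insert h Q" by blast
    then have "h \<notin> Q" unfolding R by blast
    then have "flip h Q = insert h Q" "flip h (insert h Q) = Q" by (simp_all add: flip_def)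
    then show "P \<in> {P \<in> sign_patterns I A w. flip h P \<in> sign_patterns I A w}"
      using Q unfolding R by (elim disjE) simp_all
  qed
  moreover have "?R \<inter> insert h ` ?R = {}" unfolding R by auto
  moreover have "card (insert h ` ?R) = card ?R"
    by (rule card_image) (auto simp: R inj_on_def)
  ultimately show ?thesis using fin by (simp add: card_Un_disjoint)
qed

text \<open>The normals of the walls of a chamber span the dual space: otherwise some direction is
  parallel to all walls, and leaving the chamber from a generic point in that direction crosses a
  further wall.\<close>

lemma card_walls_ge:
  fixes w :: "'a \<Rightarrow> 'i \<Rightarrow> real"
  assumes "finite A" "finite I"
    and indep: "\<And>a b s t. a \<in> A \<Longrightarrow> b \<in> A \<Longrightarrow> a \<noteq> b \<Longrightarrow> s \<noteq> 0 \<Longrightarrow> \<exists>i\<in>I. s * w a i + t * w b i \<noteq> 0"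
    and nz: "\<And>a. a \<in> A \<Longrightarrow> \<exists>i\<in>I. w a i \<noteq> 0"
    and span: "\<And>d. \<exists>i\<in>I. d i \<noteq> 0 \<Longrightarrow> \<exists>a\<in>A. dot I (w a) d \<noteq> 0"
    and P: "P \<in> sign_patterns I A w"
  shows "card I \<le> card {h \<in> A. flip h P \<in> sign_patterns I A w}"
proof (rule ccontr)
  define W where "W = {h \<in> A. flip h P \<in> sign_patterns I A w}"
  assume "\<not> ?thesis"
  then obtain d0 where d0: "\<exists>i\<in>I. d0 i \<noteq> 0" "\<forall>h\<in>W. dot I (w h) d0 = 0"
    using homogeneous_system[of W I w] assms by (auto simp: W_def)
  \<comment> \<open>Normals reoriented so that the chamber is where all of them are
    positive.\<close>
  define u where "u a = (\<lambda>i. (if a \<in> P then 1 else -1) * w a i)" for a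
  have u: "dot I (u a) y = (if a \<in> P then 1 else -1) * dot I (w a) y" for a y
    unfolding u_def dot_scale_left ..
  obtain a0 where a0: "a0 \<in> A" "dot I (w a0) d0 \<noteq> 0" using span d0 by blast
  then have ua0: "dot I (u a0) d0 \<noteq> 0" by (simp add: u)
  \<comment> \<open>The direction \<open>d0\<close>, with its sign chosen so that the form of
    \<open>a0\<close> decreases along it; hence \<open>D\<close>, the forms that will be crossed, is
    nonempty.\<close>
  define d where "d = (\<lambda>i. - sgn (dot I (u a0) d0) * d0 i + 0 * d0 i)"
  have d: "dot I y d = - sgn (dot I (u a0) d0) * dot I y d0" for y
    unfolding d_def dot_combine_right by simp
  define D where "D = {a \<in> A. dot I (u a) d < 0}"
  have "a0 \<in> D" using a0 ua0 by (auto simp: D_def d sgn_real_def)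
  have "finite D" using assms by (auto simp: D_def)
  obtain x where "P \<subseteq> A" "\<And>a. a \<in> P \<Longrightarrow> dot I (w a) x > 0" "\<And>a. a \<in> A - P \<Longrightarrow> dot I (w a) x < 0"
    using P by (elim sign_patternsE) auto
  then have x: "dot I (u a) x > 0" if "a \<in> A" for a using that by (auto simp: u)
  \<comment> \<open>This form vanishes at \<open>y\<close> exactly when the ray from
    \<open>y\<close> along \<open>d\<close> meets the hyperplanes of \<open>a\<close> and
    \<open>b\<close> simultaneously. It is a nonzero form because distinct normals are not parallel,
    so a generic \<open>y\<close> avoids such ties.\<close>
  define v where "v a b = (\<lambda>i. dot I (u b) d * u a i + (- dot I (u a) d) * u b i)" for a b
  define B where "B = u ` A \<union> (\<lambda>(a, b). v a b) ` {(a, b). a \<in> D \<and> b \<in> D \<and> a \<noteq> b}"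
  have "finite B"
  proof -
    have "finite {(a, b). a \<in> D \<and> b \<in> D \<and> a \<noteq> b}"
      by (rule finite_subset[of _ "D \<times> D"]) (use \<open>finite D\<close> in auto)
    then show ?thesis using assms by (auto simp: B_def)
  qed
  moreover have "\<exists>z\<in>UNIV. dot I b z \<noteq> 0" if "b \<in> B" for b
  proof -
    have "\<exists>i\<in>I. b i \<noteq> 0"
      using that unfolding B_def
    proof (elim UnE imageE)
      fix a assume "a \<in> A" "b = u a"
      then show ?thesis using nz[of a] by (auto simp: u_def)
    next
      fix ab assume "b = (case ab of (a, b) \<Rightarrow> v a b)" "ab \<in> {(a, b). a \<in> D \<and> b \<in> D \<and> a \<noteq> b}"
      then obtain a c where ac: "a \<in> D" "c \<in> D" "a \<noteq> c" "b = v a c" by auto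
      then have "dot I (u c) d * (if a \<in> P then 1 else -1) \<noteq> 0" by (auto simp: D_def)
      then obtain i where "i \<in> I" "dot I (u c) d * (if a \<in> P then 1 else -1) * w a i +
          (- dot I (u a) d * (if c \<in> P then 1 else -1)) * w c i \<noteq> 0"
        using indep[of a c] ac D_def by blast
      then show ?thesis using ac by (intro bexI[of _ i]) (auto simp: v_def u_def split: if_splits)
    qed
    then obtain i where "i \<in> I" "b i \<noteq> 0" by auto
    from dot_self_pos[of I i b, OF assms(2) this] show ?thesis by (intro bexI[of _ b]) auto
  qed
  ultimately obtain y where y: "\<forall>b\<in>B. dot I b y \<noteq> 0 \<and> (dot I b x \<noteq> 0 \<longrightarrow> sgn (dot I b y) = sgn (dot I b x))"
    using generic_perturbation[of B x UNIV I] by auto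
  have yp: "dot I (u a) y > 0" if "a \<in> A" for a
  proof -
    have "u a \<in> B" using that by (auto simp: B_def)
    then have "sgn (dot I (u a) y) = 1" using y x[OF that] by auto
    then show ?thesis by (simp add: sgn_1_pos)
  qed
  \<comment> \<open>The time at which the ray from \<open>y\<close> along \<open>d\<close> reaches
    the hyperplane of \<open>a\<close>.\<close>
  define t where "t a = dot I (u a) y / (- dot I (u a) d)" for a
  have inj: "t a \<noteq> t b" if "a \<in> D" "b \<in> D" "a \<noteq> b" for a b
  proof
    assume "t a = t b"
    moreover have "dot I (u a) d < 0" "dot I (u b) d < 0" using that by (auto simp: D_def)
    ultimately have "dot I (v a b) y = 0"
      unfolding v_def dot_combine_left by (simp add: t_def field_simps)
    moreover have "v a b \<in> B" using that by (auto simp: B_def)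
    ultimately show False using y by auto
  qed
  obtain m where m: "m \<in> D" "\<forall>b\<in>D. t m \<le> t b"
    using finite_ne_induct[OF \<open>finite D\<close>] \<open>a0 \<in> D\<close> arg_min_if_finite(1)[of D t]
      arg_min_least[of D _ t] \<open>finite D\<close> by (metis empty_iff)
  have m': "t m < t b" if "b \<in> D - {m}" for b
    using m inj[of m b] that by (auto simp: order_less_le)
  \<comment> \<open>A time strictly between the first crossing and the second: only \<open>m\<close>
    has changed sign there.\<close>
  obtain r where r: "t m < r" "\<And>b. b \<in> D - {m} \<Longrightarrow> r < t b"
  proof -
    have "\<forall>\<^sub>F r in at_right (t m). \<forall>b\<in>D-{m}. r < t b"
    proof (intro eventually_ball_finite ballI)
      fix b assume "b \<in> D - {m}"
      from eventually_at_right_real[OF m'[OF this]] show "\<forall>\<^sub>F r in at_right (t m). r < t b"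
        by eventually_elim auto
    qed (use \<open>finite D\<close> in auto)
    then have "\<forall>\<^sub>F r in at_right (t m). t m < r \<and> (\<forall>b\<in>D-{m}. r < t b)"
      using eventually_at_right_less[of "t m"] by eventually_elim auto
    from eventually_happens'[OF _ this] show ?thesis using that by auto
  qed
  have "t m > 0" proof -
    have "m \<in> A" "dot I (u m) d < 0" using m(1) unfolding D_def by blast+
    then show ?thesis using yp[of m] unfolding t_def by (intro divide_pos_pos) simp_all
  qed
  define z where "z = (\<lambda>i. y i + r * d i)"
  have z: "dot I q z = dot I q y + r * dot I q d" for q unfolding z_def dot_add_right ..
  have zm: "dot I (u m) z < 0"
  proof -
    have "dot I (u m) d < 0" using m by (auto simp: D_def)
    then show ?thesis using r(1) by (simp add: z t_def field_simps)
  qed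
  have zo: "dot I (u b) z > 0" if "b \<in> A - {m}" for b
  proof (cases "b \<in> D")
    case True
    then have "dot I (u b) d < 0" by (auto simp: D_def)
    then show ?thesis using r(2)[of b] True that by (simp add: z t_def field_simps)
  next
    case False
    then have "dot I (u b) d \<ge> 0" using that by (auto simp: D_def)
    then have "r * dot I (u b) d \<ge> 0" using r(1) \<open>t m > 0\<close> by simp
    then show ?thesis using yp[of b] that by (simp add: z)
  qed
  have "m \<in> A" using m by (simp add: D_def)
  have "flip m P \<in> sign_patterns I A w"
  proof (rule sign_patternsI[of _ _ _ z])
    fix a assume "a \<in> A"
    then have "dot I (u a) z \<noteq> 0" "dot I (u a) z > 0 \<longleftrightarrow> a \<noteq> m"
      using zm zo[of a] by (cases "a = m"; force)+
    then show "dot I (w a) z \<noteq> 0" "(0 < dot I (w a) z) = (a \<in> flip m P)"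
      by (auto simp: u mem_flip_iff split: if_splits)
  next
    show "flip m P \<subseteq> A" using \<open>P \<subseteq> A\<close> \<open>m \<in> A\<close> by (auto simp: flip_def)
  qed
  then have "m \<in> W" using \<open>m \<in> A\<close> by (simp add: W_def)
  then have "dot I (w m) d0 = 0" using d0 by auto
  then show False using m by (auto simp: D_def d u)
qed

subsection \<open>Chambers as sign patterns\<close>

text \<open>A form without zeros on a connected set keeps its sign there; conversely the segment
  between two points with equal patterns stays in the convex set \<open>E\<close> and off all
  hyperplanes. So the components are the fibres of the pattern map. \<open>E\<close> is abstract to
  cover both the full space and the zero-sum space, and only the union of the hyperplanes enters, so
  different index sets for them are allowed.\<close>

lemma card_chambers:
  fixes E :: "(nat \<Rightarrow> real) set" and w :: "'a \<Rightarrow> nat \<Rightarrow> real"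
  assumes convex: "\<And>x y t. x \<in> E \<Longrightarrow> y \<in> E \<Longrightarrow> 0 \<le> t \<Longrightarrow> t \<le> 1 \<Longrightarrow> (\<lambda>i. (1 - t) * x i + t * y i) \<in> E"
    and union: "E \<inter> \<Union>\<A> = {x \<in> E. \<exists>a\<in>A. dot I (w a) x = 0}"
  shows "card (chambers (top_of_set E) \<A>) =
    card {sign_pattern I A w x | x. x \<in> E \<and> (\<forall>a\<in>A. dot I (w a) x \<noteq> 0)}"
proof -
  define S where "S = {x \<in> E. \<forall>a\<in>A. dot I (w a) x \<noteq> 0}"
  define pat where "pat = sign_pattern I A w"
  define C where "C P = {x \<in> S. pat x = P}" for P
  have "E - \<Union>\<A> = S" using union unfolding S_def by blast
  then have ch: "chambers (top_of_set E) \<A> = connected_components_of (top_of_set S)"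
    by (simp add: chambers_def subtopology_subtopology Int_absorb1 S_def)
  have sub: "connectedin (top_of_set S) T \<longleftrightarrow> T \<subseteq> S \<and> connected T" for T
    by (auto simp: connectedin_subtopology)
  have comp: "connected_component_of (top_of_set S) x y \<longleftrightarrow> y \<in> S \<and> pat y = pat x" if "x \<in> S" for x y
  proof
    assume "connected_component_of (top_of_set S) x y"
    then obtain T where T: "T \<subseteq> S" "connected T" "x \<in> T" "y \<in> T"
      unfolding connected_component_of_def sub by auto
    have "0 < dot I (w a) x \<longleftrightarrow> 0 < dot I (w a) y" if "a \<in> A" for a
    proof -
      have "continuous_on T (\<lambda>x. dot I (w a) x)"
        unfolding dot_def
        by (intro continuous_intros continuous_on_subset[OF continuous_on_product_coordinates]) auto
      then have conn: "connected (dot I (w a) ` T)" using T by (intro connected_continuous_image)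
      have "0 \<notin> dot I (w a) ` T" using T that by (auto simp: S_def)
      moreover have "{dot I (w a) x..dot I (w a) y} \<subseteq> dot I (w a) ` T"
        "{dot I (w a) y..dot I (w a) x} \<subseteq> dot I (w a) ` T"
        using connected_contains_Icc[OF conn] T by auto
      ultimately show ?thesis by (meson atLeastAtMost_iff not_le order.strict_iff_order subset_iff)
    qed
    then show "y \<in> S \<and> pat y = pat x" using T by (auto simp: pat_def sign_pattern_def)
  next
    assume y: "y \<in> S \<and> pat y = pat x"
    define p where "p t = (\<lambda>i. (1 - t) * x i + t * y i)" for t
    have "p t \<in> S" if t: "t \<in> {0..1}" for t
    proof -
      have "dot I (w a) (p t) \<noteq> 0" if a: "a \<in> A" for a
      proof -
        have nz: "dot I (w a) x \<noteq> 0" "dot I (w a) y \<noteq> 0" using \<open>x \<in> S\<close> y a by (auto simp: S_def)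
        have "0 < dot I (w a) y \<longleftrightarrow> 0 < dot I (w a) x"
          using y a by (auto simp: pat_def sign_pattern_def set_eq_iff)
        then consider "0 < dot I (w a) x" "0 < dot I (w a) y" | "dot I (w a) x < 0" "dot I (w a) y < 0"
          using nz by linarith
        then show ?thesis
        proof cases
          case 1
          then have "0 < dot I (w a) (p t)"
            using t convex_bound_lt[of "- dot I (w a) x" 0 "- dot I (w a) y" "1 - t" t]
            by (simp add: p_def dot_combine_right)
          then show ?thesis by simp
        next
          case 2
          then have "dot I (w a) (p t) < 0"
            using t convex_bound_lt[of "dot I (w a) x" 0 "dot I (w a) y" "1 - t" t]
            by (simp add: p_def dot_combine_right)
          then show ?thesis by simp
        qed
      qed
      then show ?thesis using convex[of x y t] \<open>x \<in> S\<close> y t by (auto simp: S_def p_def)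
    qed
    moreover have "connected (p ` {0..1})"
      unfolding p_def
      by (intro connected_continuous_image continuous_on_coordinatewise_then_product continuous_intros) auto
    moreover have "p 0 \<in> p ` {0..1}" "p 1 \<in> p ` {0..1}" by auto
    then have "x \<in> p ` {0..1}" "y \<in> p ` {0..1}" by (simp_all add: p_def)
    ultimately have "connectedin (top_of_set S) (p ` {0..1}) \<and> x \<in> p ` {0..1} \<and> y \<in> p ` {0..1}"
      unfolding sub by blast
    then show "connected_component_of (top_of_set S) x y"
      unfolding connected_component_of_def by blast
  qed
  have "connected_component_of_set (top_of_set S) x = C (pat x)" if "x \<in> S" for x
    using comp[OF that] by (auto simp: C_def)
  then have "connected_components_of (top_of_set S) = C ` pat ` S"
    unfolding connected_components_of_def image_image by (intro image_cong) auto
  moreover have "inj_on C (pat ` S)"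
  proof (rule inj_onI)
    fix P Q assume "P \<in> pat ` S" "Q \<in> pat ` S" and eq: "C P = C Q"
    then obtain x where "x \<in> C P" "P = pat x" by (auto simp: C_def)
    then show "P = Q" unfolding eq by (simp add: C_def)
  qed
  moreover have "{sign_pattern I A w x | x. x \<in> E \<and> (\<forall>a\<in>A. dot I (w a) x \<noteq> 0)} = pat ` S"
    by (auto simp: S_def pat_def)
  ultimately show ?thesis unfolding ch by (simp add: card_image)
qed

text \<open>Hyperplanes are indexed by \<open>S \<subseteq> {..<n}\<close> among coordinates
  \<open>{..n}\<close>: the last coordinate is then 1, which selects one normal from each pair of
  opposite ones.\<close>

definition sign_vec :: "'i set \<Rightarrow> 'i \<Rightarrow> real" where
  "sign_vec S i = (if i \<in> S then -1 else 1)"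

definition zero_above :: "nat \<Rightarrow> (nat \<Rightarrow> real) set" where
  "zero_above n = {x. \<forall>i>n. x i = 0}"

lemma Euclidean_space_Suc_eq: "Euclidean_space (n + 1) = top_of_set (zero_above n)"
  by (simp add: Euclidean_space_def zero_above_def euclidean_product_topology Suc_le_eq)

lemma T_eq_card_sign_patterns: "T n = card (sign_patterns {..n} (Pow {..<n}) sign_vec)"
proof -
  let ?E = "zero_above n" and ?d = "\<lambda>S. dot {..n} (sign_vec S)"
  have "?E \<inter> \<Union>(threshold_arrangement (n + 1)) = {x \<in> ?E. \<exists>S\<in>Pow {..<n}. ?d S x = 0}"
  proof (intro equalityI subsetI)
    fix x assume "x \<in> ?E \<inter> \<Union>(threshold_arrangement (n + 1))"
    then obtain v where x: "x \<in> ?E" and v: "\<forall>i\<le>n. v i \<in> {-1, 1}" "(\<Sum>i\<le>n. v i * x i) = 0"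
      by (auto simp: threshold_arrangement_def lessThan_Suc_atMost less_Suc_eq_le)
    \<comment> \<open>Multiplying \<open>v\<close> by its last entry keeps the hyperplane and makes
      the last coordinate 1.\<close>
    define S where "S = {i. i < n \<and> v i \<noteq> v n}"
    have "sign_vec S i = v n * v i" if "i \<le> n" for i
      using that v(1)[rule_format, of i] v(1)[rule_format, of n] by (auto simp: sign_vec_def S_def)
    then have "?d S x = v n * (\<Sum>i\<le>n. v i * x i)"
      unfolding dot_def sum_distrib_left by (intro sum.cong) (auto simp: mult_ac)
    then show "x \<in> {x \<in> ?E. \<exists>S\<in>Pow {..<n}. ?d S x = 0}"
      using x v by (auto simp: S_def intro!: bexI[of _ S])
  next
    fix x assume "x \<in> {x \<in> ?E. \<exists>S\<in>Pow {..<n}. ?d S x = 0}"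
    then obtain S where x: "x \<in> ?E" and S: "?d S x = 0" by auto
    have "{x \<in> topspace (Euclidean_space (n + 1)). (\<Sum>i<n + 1. sign_vec S i * x i) = 0}
       \<in> threshold_arrangement (n + 1)"
      unfolding threshold_arrangement_def
      by (intro CollectI exI[of _ "sign_vec S"]) (auto simp: sign_vec_def)
    moreover have "x \<in> {x \<in> topspace (Euclidean_space (n + 1)). (\<Sum>i<n + 1. sign_vec S i * x i) = 0}"
      using x S by (simp only: Euclidean_space_Suc_eq) (simp add: dot_def lessThan_Suc_atMost)
    ultimately show "x \<in> ?E \<inter> \<Union>(threshold_arrangement (n + 1))" using x by blast
  qed
  then have "T n = card {sign_pattern {..n} (Pow {..<n}) sign_vec x | x.
      x \<in> ?E \<and> (\<forall>S\<in>Pow {..<n}. ?d S x \<noteq> 0)}"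
    unfolding T_def Euclidean_space_Suc_eq by (intro card_chambers) (auto simp: zero_above_def)
  also have "{sign_pattern {..n} (Pow {..<n}) sign_vec x | x.
      x \<in> ?E \<and> (\<forall>S\<in>Pow {..<n}. ?d S x \<noteq> 0)} = sign_patterns {..n} (Pow {..<n}) sign_vec"
  proof (intro equalityI subsetI)
    fix P assume "P \<in> sign_patterns {..n} (Pow {..<n}) sign_vec"
    then obtain x where x: "P = sign_pattern {..n} (Pow {..<n}) sign_vec x" "\<forall>S\<in>Pow {..<n}. ?d S x \<noteq> 0"
      by (auto simp: sign_patterns_def)
    \<comment> \<open>\<open>sign_patterns\<close> ranges over all functions; cutting off the
      coordinates above \<open>n\<close> moves the point into the Euclidean space without changing
      any form.\<close>
    define y where "y i = (if i \<le> n then x i else 0)" for i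
    have "?d S y = ?d S x" for S by (auto simp: dot_def y_def intro!: sum.cong)
    then have "P = sign_pattern {..n} (Pow {..<n}) sign_vec y" "\<forall>S\<in>Pow {..<n}. ?d S y \<noteq> 0"
      using x by (simp_all add: sign_pattern_def)
    moreover have "y \<in> ?E" by (simp add: y_def zero_above_def)
    ultimately show "P \<in> {sign_pattern {..n} (Pow {..<n}) sign_vec x | x.
      x \<in> ?E \<and> (\<forall>S\<in>Pow {..<n}. ?d S x \<noteq> 0)}" by blast
  qed (auto simp: sign_patterns_def)
  finally show ?thesis .
qed

text \<open>The index \<open>{}\<close> is the all-ones normal, whose hyperplane is the zero-sum
  space. On that space the form of \<open>S\<close> is -2 times the sum over \<open>S\<close>, and a
  set and its complement give the same hyperplane, so subsets containing \<open>n\<close> can be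
  replaced by their complements.\<close>

lemma R_eq_card_restricted_patterns:
  "R n = card (restricted_patterns {..n} (Pow {..<n}) sign_vec {})"
proof -
  let ?d = "\<lambda>S. dot {..n} (sign_vec S)" and ?A = "Pow {..<n} - {{}}"
  let ?E = "zero_above n \<inter> {x. (\<Sum>i\<le>n. x i) = 0}"
  have V: "zero_sum_space n = top_of_set ?E"
    by (simp only: zero_sum_space_def Euclidean_space_Suc_eq subtopology_subtopology)
  have dS: "?d S x = - 2 * (\<Sum>i\<in>S. x i)" if "S \<subseteq> {..n}" "(\<Sum>i\<le>n. x i) = 0" for S x
  proof -
    have "?d S x = (\<Sum>i\<le>n. x i - 2 * (if i \<in> S then x i else 0))"
      unfolding dot_def by (intro sum.cong) (auto simp: sign_vec_def)
    also have "\<dots> = (\<Sum>i\<le>n. x i) - 2 * (\<Sum>i\<le>n. if i \<in> S then x i else 0)"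
      by (simp add: sum_subtractf sum_distrib_left)
    also have "(\<Sum>i\<le>n. if i \<in> S then x i else 0) = (\<Sum>i\<in>S. x i)"
      using that(1) by (subst sum.If_cases) (auto intro!: sum.cong simp: Int_absorb1)
    finally show ?thesis using that by simp
  qed
  have "?E \<inter> \<Union>(resonance_arrangement n) = {x \<in> ?E. \<exists>S\<in>?A. ?d S x = 0}"
  proof (intro equalityI subsetI)
    fix x assume "x \<in> ?E \<inter> \<Union>(resonance_arrangement n)"
    then obtain S where x: "x \<in> ?E" and S: "S \<noteq> {}" "S \<subset> {..n}" "(\<Sum>i\<in>S. x i) = 0"
      by (auto simp: resonance_arrangement_def)
    define S' where "S' = (if n \<in> S then {..n} - S else S)"
    have "(\<Sum>i\<in>{..n} - S. x i) = (\<Sum>i\<le>n. x i) - (\<Sum>i\<in>S. x i)"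
      using S by (intro sum_diff) auto
    then have "(\<Sum>i\<in>S'. x i) = 0" using x S by (simp add: S'_def)
    moreover have sub: "S' \<subseteq> {..n}" using S by (auto simp: S'_def)
    ultimately have "?d S' x = 0" using dS[of S' x] x by simp
    moreover have "n \<notin> S'" by (simp add: S'_def)
    with sub have "S' \<subseteq> {..<n}" by (metis atMost_iff lessThan_iff order_less_le subset_iff)
    moreover have "S' \<noteq> {}" using S by (auto simp: S'_def)
    ultimately show "x \<in> {x \<in> ?E. \<exists>S\<in>?A. ?d S x = 0}" using x by blast
  next
    fix x assume "x \<in> {x \<in> ?E. \<exists>S\<in>?A. ?d S x = 0}"
    then obtain S where x: "x \<in> ?E" and S: "S \<subseteq> {..<n}" "S \<noteq> {}" "?d S x = 0" by auto
    have "S \<subseteq> {..n}" using S by auto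
    then have "(\<Sum>i\<in>S. x i) = 0" using dS[of S x] x S by simp
    moreover have "n \<notin> S" using S by auto
    then have "S \<subset> {..n}" using \<open>S \<subseteq> {..n}\<close> by auto
    then have "{x \<in> topspace (zero_sum_space n). (\<Sum>i\<in>S. x i) = 0} \<in> resonance_arrangement n"
      unfolding resonance_arrangement_def using S by blast
    moreover have "x \<in> topspace (zero_sum_space n)" using x by (simp add: V)
    ultimately show "x \<in> ?E \<inter> \<Union>(resonance_arrangement n)" using x by blast
  qed
  then have "R n = card {sign_pattern {..n} ?A sign_vec x | x. x \<in> ?E \<and> (\<forall>S\<in>?A. ?d S x \<noteq> 0)}"
    unfolding R_def V
    by (intro card_chambers)
      (auto simp: zero_above_def sum.distrib simp flip: sum_distrib_left)
  also have "{sign_pattern {..n} ?A sign_vec x | x. x \<in> ?E \<and> (\<forall>S\<in>?A. ?d S x \<noteq> 0)}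
     = restricted_patterns {..n} (Pow {..<n}) sign_vec {}"
  proof (intro equalityI subsetI)
    fix P assume "P \<in> {sign_pattern {..n} ?A sign_vec x | x. x \<in> ?E \<and> (\<forall>S\<in>?A. ?d S x \<noteq> 0)}"
    then obtain x where "P = sign_pattern {..n} ?A sign_vec x" "x \<in> ?E" "\<forall>S\<in>?A. ?d S x \<noteq> 0" by blast
    then show "P \<in> restricted_patterns {..n} (Pow {..<n}) sign_vec {}"
      unfolding restricted_patterns_def using dS[of "{}" x] by auto
  next
    fix P assume "P \<in> restricted_patterns {..n} (Pow {..<n}) sign_vec {}"
    then obtain x where x: "P = sign_pattern {..n} ?A sign_vec x" "?d {} x = 0" "\<forall>S\<in>?A. ?d S x \<noteq> 0"
      unfolding restricted_patterns_def by blast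
    define y where "y i = (if i \<le> n then x i else 0)" for i
    have dy: "?d S y = ?d S x" for S by (auto simp: dot_def y_def intro!: sum.cong)
    then have "P = sign_pattern {..n} ?A sign_vec y" "\<forall>S\<in>?A. ?d S y \<noteq> 0"
      using x by (simp_all add: sign_pattern_def)
    moreover have "y \<in> ?E"
      using x(2) unfolding dy[of "{}", symmetric] by (simp add: y_def zero_above_def dot_def sign_vec_def)
    ultimately show "P \<in> {sign_pattern {..n} ?A sign_vec x | x. x \<in> ?E \<and> (\<forall>S\<in>?A. ?d S x \<noteq> 0)}" by blast
  qed
  finally show ?thesis .
qed

subsection \<open>Comparison of the two arrangements\<close>

abbreviation threshold_patterns :: "nat \<Rightarrow> nat set set set" where
  "threshold_patterns n \<equiv> sign_patterns {..n} (Pow {..<n}) sign_vec"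

text \<open>Both vectors end in 1, so a relation would force \<open>t = - s\<close>; a coordinate
  where they differ then refutes it.\<close>

lemma sign_vec_nonparallel:
  fixes n :: nat
  assumes "a \<subseteq> {..<n}" "b \<subseteq> {..<n}" "a \<noteq> b" "s \<noteq> (0::real)"
  shows "\<exists>i\<in>{..n}. s * sign_vec a i + t * sign_vec b i \<noteq> 0"
proof (cases "s + t = 0")
  case True
  obtain i where i: "i < n" "(i \<in> a) \<noteq> (i \<in> b)" using assms by (metis lessThan_iff subset_antisym subset_iff)
  moreover have "i \<in> {..n}" using i(1) by simp
  moreover have "t = - s" using True by simp
  ultimately show ?thesis using assms(4) by (intro bexI[of _ i]) (auto simp: sign_vec_def)
next
  case False
  have "n \<notin> a" "n \<notin> b" using assms by auto
  then show ?thesis using False by (intro bexI[of _ n]) (auto simp: sign_vec_def)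
qed

text \<open>The normals span: \<open>sign_vec {} - sign_vec {i}\<close> isolates coordinate
  \<open>i < n\<close>, after which \<open>sign_vec {}\<close> isolates coordinate
  \<open>n\<close>.\<close>

lemma sign_vec_separates:
  fixes n :: nat
  assumes "\<exists>i\<in>{..n}. d i \<noteq> 0"
  shows "\<exists>S\<in>Pow {..<n}. dot {..n} (sign_vec S) d \<noteq> 0"
proof (rule ccontr)
  assume "\<not> ?thesis"
  then have zero: "dot {..n} (sign_vec S) d = 0" if "S \<subseteq> {..<n}" for S using that by auto
  have d: "d i = 0" if "i < n" for i
  proof -
    have "dot {..n} (sign_vec {}) d - dot {..n} (sign_vec {i}) d = (\<Sum>j\<le>n. if j = i then 2 * d j else 0)"
      unfolding dot_def sum_subtractf[symmetric] by (intro sum.cong) (auto simp: sign_vec_def)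
    also have "\<dots> = 2 * d i" using that by (subst sum.delta) auto
    finally show ?thesis using zero[of "{}"] zero[of "{i}"] that by simp
  qed
  have "dot {..n} (sign_vec {}) d = (\<Sum>j\<le>n. if j = n then d j else 0)"
    unfolding dot_def by (intro sum.cong) (auto simp: sign_vec_def d)
  then have "d n = 0" using zero[of "{}"] by simp
  with d assms show False by (metis atMost_iff le_neq_implies_less)
qed

lemma sign_vec_mult: "sign_vec S i * sign_vec U i = sign_vec (sym_diff S U) i"
  by (auto simp: sign_vec_def)

lemma sign_vec_cases: "sign_vec S i = 1 \<or> sign_vec S i = -1"
  by (simp add: sign_vec_def)

text \<open>Changing the signs of the coordinates in \<open>h\<close> maps the hyperplane of \<open>h\<close> to that of the
  all-ones vector.\<close>

lemma card_flippable_symmetric: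
  assumes h: "h \<subseteq> {..<n}"
  shows "card {P \<in> threshold_patterns n. flip h P \<in> threshold_patterns n} \<le>
     card {P \<in> threshold_patterns n. flip {} P \<in> threshold_patterns n}"
proof -
  define twist where "twist P = {S. sym_diff S h \<in> P}" for P
  have sd: "sym_diff (sym_diff S h) h = S" for S by auto
  have sd0: "sym_diff S h = h \<longleftrightarrow> S = {}" for S by auto
  have inv: "twist (twist P) = P" for P by (simp add: twist_def sd)
  have tw: "twist P \<in> threshold_patterns n" if P: "P \<in> threshold_patterns n" for P
  proof -
    have "\<exists>x. P \<subseteq> Pow {..<n} \<and> (\<forall>a\<in>P. dot {..n} (sign_vec a) x > 0) \<and>
        (\<forall>a\<in>Pow {..<n} - P. dot {..n} (sign_vec a) x < 0)"
      using P by (elim sign_patternsE) blast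
    then obtain x where x: "P \<subseteq> Pow {..<n}" "\<And>a. a \<in> P \<Longrightarrow> dot {..n} (sign_vec a) x > 0"
      "\<And>a. a \<in> Pow {..<n} - P \<Longrightarrow> dot {..n} (sign_vec a) x < 0"
      by blast
    have d: "dot {..n} (sign_vec a) (\<lambda>i. sign_vec h i * x i) = dot {..n} (sign_vec (sym_diff a h)) x" for a
      unfolding dot_def by (simp add: sign_vec_mult[symmetric] mult_ac)
    have *: "a \<in> Pow {..<n} \<longleftrightarrow> sym_diff a h \<in> Pow {..<n}" for a using h by auto
    show ?thesis
    proof (rule sign_patternsI[of _ _ _ "\<lambda>i. sign_vec h i * x i"])
      fix a assume "a \<in> Pow {..<n}"
      then have "sym_diff a h \<in> Pow {..<n}" using * by blast
      then show "dot {..n} (sign_vec a) (\<lambda>i. sign_vec h i * x i) \<noteq> 0"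
        "0 < dot {..n} (sign_vec a) (\<lambda>i. sign_vec h i * x i) \<longleftrightarrow> a \<in> twist P"
        unfolding d twist_def using x(2,3)[of "sym_diff a h"] by fastforce+
    next
      show "twist P \<subseteq> Pow {..<n}" using x(1) * unfolding twist_def by blast
    qed
  qed
  have flip: "twist (flip h P) = flip {} (twist P)" for P
  proof (rule set_eqI)
    fix S
    have "S \<in> twist (flip h P) \<longleftrightarrow> (if S = {} then h \<notin> P else sym_diff S h \<in> P)"
      unfolding mem_flip_iff twist_def mem_Collect_eq sd0 by (cases "S = {}") simp_all
    also have "\<dots> \<longleftrightarrow> S \<in> flip {} (twist P)"
      by (simp add: mem_flip_iff twist_def)
    finally show "S \<in> twist (flip h P) \<longleftrightarrow> S \<in> flip {} (twist P)" .
  qed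
  show ?thesis
  proof (rule card_inj_on_le[of twist])
    show "inj_on twist {P \<in> threshold_patterns n. flip h P \<in> threshold_patterns n}"
      by (rule inj_on_inverseI[of _ twist]) (rule inv)
    show "twist ` {P \<in> threshold_patterns n. flip h P \<in> threshold_patterns n} \<subseteq>
        {P \<in> threshold_patterns n. flip {} P \<in> threshold_patterns n}"
      using tw flip by (auto simp flip: flip)
    show "finite {P \<in> threshold_patterns n. flip {} P \<in> threshold_patterns n}"
      by (simp add: finite_sign_patterns)
  qed
qed

lemma card_flippable_empty_eq_R:
  "card {P \<in> threshold_patterns n. flip {} P \<in> threshold_patterns n} = 2 * R n"
proof -
  have "\<exists>i\<in>{..n}. sign_vec {} i \<noteq> 0" by (auto simp: sign_vec_def)
  then show ?thesis
    unfolding R_eq_card_restricted_patterns by (intro card_flippable) auto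
qed

lemma card_walls_threshold_ge:
  assumes "P \<in> threshold_patterns n"
  shows "n + 1 \<le> card {h \<in> Pow {..<n}. flip h P \<in> threshold_patterns n}"
proof -
  have "card {..n} \<le> card {h \<in> Pow {..<n}. flip h P \<in> threshold_patterns n}"
  proof (rule card_walls_ge)
    fix a b :: "nat set" and s t :: real
    assume "a \<in> Pow {..<n}" "b \<in> Pow {..<n}" "a \<noteq> b" "s \<noteq> 0"
    then show "\<exists>i\<in>{..n}. s * sign_vec a i + t * sign_vec b i \<noteq> 0"
      by (intro sign_vec_nonparallel) auto
  next
    fix a :: "nat set" show "\<exists>i\<in>{..n}. sign_vec a i \<noteq> 0" by (auto simp: sign_vec_def)
  qed (use assms sign_vec_separates in auto)
  then show ?thesis by simp
qed

text \<open>Every hyperplane is a wall of the cone \<open>x\<^sub>0 > \<bar>x\<^sub>1\<bar> + \<dots> + \<bar>x\<^sub>n\<bar>\<close>.\<close>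

lemma dictator_flip_mem:
  assumes h: "h \<subseteq> {..<n}" and n: "n \<ge> 1"
  defines "P \<equiv> {S \<in> Pow {..<n}. 0 \<notin> S}"
  shows "flip h P \<in> threshold_patterns n"
proof -
  let ?g = "\<lambda>S i. sign_vec S i * sign_vec h i"
  \<comment> \<open>This point is just outside the cone: \<open>y 0\<close> is \<open>n - 1\<close>
    while the other coordinates have absolute sum \<open>n\<close>. A form can differ in sign from
    its first term only if all its other terms align against that term. The alignment sum moves in
    steps of 2, so its next value \<open>n - 2\<close> is already harmless. One alignment is
    \<open>S = h\<close>; the other would be the opposite vector, excluded by the common last
    coordinate 1.\<close>
  define y where "y i = (if i = 0 then real n - 1 else - (sign_vec h 0 * sign_vec h i))" for i
  have dec: "{..n} = insert 0 {1..n}" by auto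
  have dy: "dot {..n} (sign_vec S) y = sign_vec S 0 * (real n - 1) - sign_vec h 0 * (\<Sum>i=1..n. ?g S i)" for S
  proof -
    have "dot {..n} (sign_vec S) y = sign_vec S 0 * (real n - 1) + (\<Sum>i=1..n. sign_vec S i * y i)"
      unfolding dot_def dec by (subst sum.insert) (auto simp: y_def)
    also have "(\<Sum>i=1..n. sign_vec S i * y i) = - (sign_vec h 0 * (\<Sum>i=1..n. ?g S i))"
      unfolding sum_distrib_left sum_negf[symmetric] by (intro sum.cong) (auto simp: y_def)
    finally show ?thesis by simp
  qed
  have g: "?g S i \<le> 1" "?g S i \<ge> -1" for S i
    using sign_vec_cases[of S i] sign_vec_cases[of h i] by auto
  have up: "(\<Sum>i=1..n. ?g S i) \<le> real n - 2" if "i \<in> {1..n}" "?g S i = -1" for S i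
  proof -
    have "(\<Sum>i=1..n. ?g S i) = -1 + (\<Sum>i\<in>{1..n} - {i}. ?g S i)"
      using that by (subst sum.remove[of _ i]) auto
    also have "(\<Sum>i\<in>{1..n} - {i}. ?g S i) \<le> (\<Sum>i\<in>{1..n} - {i}. 1)"
      by (intro sum_mono g)
    finally show ?thesis using that by (simp add: of_nat_diff)
  qed
  have low: "(\<Sum>i=1..n. ?g S i) \<ge> 2 - real n" if "S \<subseteq> {..<n}" for S
  proof -
    have "n \<notin> S" "n \<notin> h" using that h by auto
    then have "(\<Sum>i=1..n. ?g S i) = 1 + (\<Sum>i\<in>{1..n} - {n}. ?g S i)"
      using n by (subst sum.remove[of _ n]) (auto simp: sign_vec_def)
    moreover have "(\<Sum>i\<in>{1..n} - {n}. ?g S i) \<ge> (\<Sum>i\<in>{1..n} - {n}. -1)"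
      by (intro sum_mono g)
    ultimately show ?thesis using n by (simp add: of_nat_diff)
  qed
  have *: "dot {..n} (sign_vec S) y \<noteq> 0 \<and> (dot {..n} (sign_vec S) y > 0 \<longleftrightarrow> S \<in> flip h P)"
    if S: "S \<subseteq> {..<n}" for S
  proof (cases "S = h")
    case True
    have "(\<Sum>i=1..n. ?g h i) = (\<Sum>i=1..n. 1)" by (intro sum.cong) (auto simp: sign_vec_def)
    then have "dot {..n} (sign_vec S) y = - sign_vec h 0" using True by (simp add: dy algebra_simps)
    then show ?thesis using True h by (auto simp: sign_vec_def mem_flip_iff P_def)
  next
    case False
    have "sign_vec S 0 * dot {..n} (sign_vec S) y > 0"
    proof (cases "0 \<in> S \<longleftrightarrow> 0 \<in> h")
      case True
      obtain i where i: "i < n" "(i \<in> S) \<noteq> (i \<in> h)"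
        using False S h by (metis lessThan_iff subset_antisym subset_iff)
      with True have "i \<noteq> 0" by metis
      with i have "i \<in> {1..n}" "?g S i = -1" by (auto simp: sign_vec_def)
      from up[OF this] have "real n - 1 - (\<Sum>i=1..n. ?g S i) > 0" by linarith
      moreover have "sign_vec S 0 * dot {..n} (sign_vec S) y = real n - 1 - (\<Sum>i=1..n. ?g S i)"
        unfolding dy using True by (simp add: sign_vec_def)
      ultimately show ?thesis by simp
    next
      case False
      have "sign_vec S 0 * dot {..n} (sign_vec S) y = real n - 1 + (\<Sum>i=1..n. ?g S i)"
        unfolding dy using False by (simp add: sign_vec_def)
      then show ?thesis using low[OF S] by simp
    qed
    then show ?thesis using False S by (auto simp: sign_vec_def mem_flip_iff P_def split: if_splits)
  qed
  show ?thesis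
    by (rule sign_patternsI[of _ _ _ y]) (use * h in \<open>auto simp: mem_flip_iff P_def split: if_splits\<close>)
qed

lemma dictator_mem:
  "{S \<in> Pow {..<n}. 0 \<notin> S} \<in> threshold_patterns n"
proof -
  define x :: "nat \<Rightarrow> real" where "x i = (if i = 0 then real n + 1 else 1)" for i
  have dec: "{..n} = insert 0 {1..n}" by auto
  have dx: "dot {..n} (sign_vec S) x = sign_vec S 0 * (real n + 1) + (\<Sum>i=1..n. sign_vec S i)" for S
    unfolding dot_def dec by (subst sum.insert) (auto simp: x_def intro!: sum.cong)
  have "(\<Sum>i=1..n. sign_vec S i) \<le> (\<Sum>i=1..n. 1)" "(\<Sum>i=1..n. sign_vec S i) \<ge> (\<Sum>i=1..n. -1)" for S :: "nat set"
    by (intro sum_mono; simp add: sign_vec_def)+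
  then have b: "(\<Sum>i=1..n. sign_vec S i) \<le> real n" "(\<Sum>i=1..n. sign_vec S i) \<ge> - real n" for S :: "nat set"
    by simp_all
  have "dot {..n} (sign_vec S) x \<noteq> 0 \<and> (dot {..n} (sign_vec S) x > 0 \<longleftrightarrow> 0 \<notin> S)" for S
    unfolding dx using b[of S] by (cases "0 \<in> S") (auto simp: sign_vec_def[of S 0])
  then show ?thesis by (intro sign_patternsI[of _ _ _ x]) auto
qed

theorem R_lower_bound:
  assumes "n \<ge> 2"
  shows "(n + 1) * T n < 2 ^ (n + 1) * R n"
proof -
  let ?F = "threshold_patterns n" and ?A = "Pow {..<n}"
  let ?P = "{S \<in> ?A. 0 \<notin> S}"
  have finF: "finite ?F" by (simp add: finite_sign_patterns)
  have "(n + 1) * T n = (\<Sum>P\<in>?F. n + 1)" by (simp add: T_eq_card_sign_patterns)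
  also have "\<dots> < (\<Sum>P\<in>?F. card {h \<in> ?A. flip h P \<in> ?F})"
  proof (rule sum_strict_mono_ex1[OF finF])
    show "\<forall>P\<in>?F. n + 1 \<le> card {h \<in> ?A. flip h P \<in> ?F}" using card_walls_threshold_ge by blast
    have "{h \<in> ?A. flip h ?P \<in> ?F} = ?A" using dictator_flip_mem assms by auto
    then have "card {h \<in> ?A. flip h ?P \<in> ?F} = 2 ^ n" by (simp add: card_Pow)
    \<comment> \<open>Strictness comes from this chamber and needs \<open>n \<ge> 2\<close>: for
      \<open>n = 1\<close> both sides are 2.\<close>
    moreover have "n + 1 < 2 ^ n" using assms by (induction n rule: dec_induct) auto
    ultimately show "\<exists>P\<in>?F. n + 1 < card {h \<in> ?A. flip h P \<in> ?F}"
      using dictator_mem by (intro bexI[of _ ?P]) auto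
  qed
  also have "\<dots> = (\<Sum>P\<in>?F. \<Sum>h\<in>?A. if flip h P \<in> ?F then 1 else 0)"
    by (simp add: sum.If_cases Int_def)
  also have "\<dots> = (\<Sum>h\<in>?A. \<Sum>P\<in>?F. if flip h P \<in> ?F then 1 else 0)"
    by (rule sum.swap)
  also have "\<dots> = (\<Sum>h\<in>?A. card {P \<in> ?F. flip h P \<in> ?F})"
    using finF by (simp add: sum.If_cases Int_def)
  also have "\<dots> \<le> (\<Sum>h\<in>?A. 2 * R n)"
    by (intro sum_mono) (simp add: card_flippable_symmetric flip: card_flippable_empty_eq_R)
  also have "\<dots> = 2 ^ (n + 1) * R n" by (simp add: card_Pow)
  finally show ?thesis .
qed

text \<open>The all-ones vector is \<open>sign_vec {0} + sign_vec {1} - sign_vec {0, 1}\<close>, so its hyperplane is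
  not a wall of a chamber where the first two forms are positive and the third is negative.\<close>

theorem R_upper_bound:
  assumes "n \<ge> 2"
  shows "2 * R n < T n"
proof -
  let ?F = "threshold_patterns n" and ?d = "\<lambda>S. dot {..n} (sign_vec S)"
  have finF: "finite ?F" by (simp add: finite_sign_patterns)
  have d: "?d {} x = ?d {0} x + ?d {1} x - ?d {0, 1} x" for x
    unfolding dot_def sum.distrib[symmetric] sum_subtractf[symmetric]
    by (intro sum.cong) (auto simp: sign_vec_def)
  \<comment> \<open>For \<open>n \<ge> 2\<close> these are three distinct coordinates, and the forms
    of \<open>{0}\<close>, \<open>{1}\<close> and \<open>{0, 1}\<close> take the values 1, 1 and
    -1.\<close>
  define x :: "nat \<Rightarrow> real" where "x i = (if i = 0 \<or> i = 1 \<or> i = n then 1 else 0)" for i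
  have dx: "?d S x = sign_vec S 0 + sign_vec S 1 + sign_vec S n" for S
  proof -
    have "?d S x = (\<Sum>i\<in>{0, 1, n}. sign_vec S i * x i)"
      unfolding dot_def using assms by (intro sum.mono_neutral_right) (auto simp: x_def)
    then show ?thesis using assms by (simp add: x_def)
  qed
  have "\<exists>y\<in>UNIV. \<forall>b\<in>sign_vec ` Pow {..<n}. dot {..n} b y \<noteq> 0 \<and>
      (dot {..n} b x \<noteq> 0 \<longrightarrow> sgn (dot {..n} b y) = sgn (dot {..n} b x))"
  proof (rule generic_perturbation)
    fix b :: "nat \<Rightarrow> real" assume "b \<in> sign_vec ` Pow {..<n}"
    then have "b 0 \<noteq> 0" by (auto simp: sign_vec_def split: if_splits)
    from dot_self_pos[of "{..n}" 0 b, OF _ _ this] show "\<exists>z\<in>UNIV. dot {..n} b z \<noteq> 0"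
      by (intro bexI[of _ b]) auto
  qed auto
  then obtain y where y: "\<And>S. S \<in> Pow {..<n} \<Longrightarrow> ?d S y \<noteq> 0"
     "\<And>S. S \<in> Pow {..<n} \<Longrightarrow> ?d S x \<noteq> 0 \<Longrightarrow> sgn (?d S y) = sgn (?d S x)" by blast
  define P where "P = sign_pattern {..n} (Pow {..<n}) sign_vec y"
  have PF: "P \<in> ?F" using y(1) unfolding P_def sign_patterns_def by blast
  have A: "{0} \<in> Pow {..<n}" "{1} \<in> Pow {..<n}" "{0, 1} \<in> Pow {..<n}" using assms by auto
  have "sgn (?d {0} y) = 1" "sgn (?d {1} y) = 1" "sgn (?d {0, 1} y) = -1"
    using y(2)[OF A(1)] y(2)[OF A(2)] y(2)[OF A(3)] assms unfolding dx by (simp_all add: sign_vec_def)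
  then have s: "?d {0} y > 0" "?d {1} y > 0" "?d {0, 1} y < 0" by (simp_all add: sgn_1_pos sgn_1_neg)
  then have "{} \<in> P" using d[of y] by (auto simp: P_def sign_pattern_def)
  have mem: "{0} \<in> P" "{1} \<in> P" "{0, 1} \<notin> P" using s A by (auto simp: P_def sign_pattern_def)
  have "flip {} P \<notin> ?F"
  proof
    assume "flip {} P \<in> ?F"
    then obtain z where z: "\<And>a. a \<in> flip {} P \<Longrightarrow> ?d a z > 0"
      "\<And>a. a \<in> Pow {..<n} - flip {} P \<Longrightarrow> ?d a z < 0" by (elim sign_patternsE) auto
    have "?d {0} z > 0" "?d {1} z > 0" "?d {0, 1} z < 0" "?d {} z < 0"
      using z(1)[of "{0}"] z(1)[of "{1}"] z(2)[of "{0, 1}"] z(2)[of "{}"] mem A \<open>{} \<in> P\<close>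
      by (auto simp: mem_flip_iff)
    then show False using d[of z] by linarith
  qed
  then have "{P \<in> ?F. flip {} P \<in> ?F} \<subset> ?F" using PF by blast
  from psubset_card_mono[OF finF this] show ?thesis
    by (simp add: card_flippable_empty_eq_R T_eq_card_sign_patterns)
qed

subsection \<open>Shattering\<close>

definition shattered :: "'a set set \<Rightarrow> 'a set \<Rightarrow> 'a set set" where
  "shattered F A = {S. S \<subseteq> A \<and> (\<forall>X\<subseteq>S. \<exists>P\<in>F. P \<inter> S = X)}"

text \<open>\<open>F\<close> contains a whole subcube with free directions \<open>S\<close> over one
  fixed background \<open>B\<close>, whereas for \<open>shattered\<close> the part outside
  \<open>S\<close> may vary with \<open>X\<close>.\<close>

definition strongly_shattered :: "'a set set \<Rightarrow> 'a set \<Rightarrow> 'a set set" where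
  "strongly_shattered F A = {S. S \<subseteq> A \<and> (\<exists>B\<subseteq>A-S. \<forall>X\<subseteq>S. B \<union> X \<in> F)}"

text \<open>Both halves of the sandwich theorem \<open>card (strongly_shattered F A) \<le> card F \<le> card (shattered F A)\<close>
  split \<open>F\<close> into the members avoiding and containing a point and use
  \<open>card F\<^sub>0 + card F\<^sub>1 = card (F\<^sub>0 \<union> F\<^sub>1) + card (F\<^sub>0 \<inter> F\<^sub>1)\<close>.\<close>

lemma card_split_point:
  assumes "finite F"
  shows "card F = card {P \<in> F. a \<notin> P} + card {P. a \<notin> P \<and> insert a P \<in> F}"
proof -
  have "F = {P \<in> F. a \<notin> P} \<union> {P \<in> F. a \<in> P}" by auto
  also have "card \<dots> = card {P \<in> F. a \<notin> P} + card {P \<in> F. a \<in> P}"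
    using assms by (intro card_Un_disjoint) auto
  also have "{P \<in> F. a \<in> P} = insert a ` {P. a \<notin> P \<and> insert a P \<in> F}"
  proof (intro equalityI subsetI)
    fix P assume "P \<in> {P \<in> F. a \<in> P}"
    then show "P \<in> insert a ` {P. a \<notin> P \<and> insert a P \<in> F}"
      by (intro image_eqI[of _ _ "P - {a}"]) (auto simp: insert_absorb)
  qed auto
  also have "card \<dots> = card {P. a \<notin> P \<and> insert a P \<in> F}"
    by (rule card_image) (auto simp: inj_on_def)
  finally show ?thesis .
qed

lemma finite_shattered: "finite A \<Longrightarrow> finite (shattered F A)"
  by (rule finite_subset[of _ "Pow A"]) (auto simp: shattered_def)

lemma finite_strongly_shattered: "finite A \<Longrightarrow> finite (strongly_shattered F A)"
  by (rule finite_subset[of _ "Pow A"]) (auto simp: strongly_shattered_def)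

text \<open>A set shattered by the union of the two halves is shattered by \<open>F\<close>; one
  shattered by both halves remains so after \<open>a\<close> is inserted. The two kinds are
  disjoint, since only the second contains \<open>a\<close>.\<close>

lemma card_le_card_shattered:
  assumes "finite A" "F \<subseteq> Pow A"
  shows "card F \<le> card (shattered F A)"
  using assms
proof (induction A arbitrary: F rule: finite_induct)
  case empty
  then have "F = {} \<or> F = {{}}" by auto
  then show ?case
  proof
    assume "F = {{}}"
    then have "shattered F {} = {{}}" by (auto simp: shattered_def)
    then show ?thesis using \<open>F = {{}}\<close> by simp
  qed simp
next
  case (insert a A)
  have finF: "finite F" using insert by (meson finite.insertI finite_Pow_iff finite_subset)
  define F0 F1 where "F0 = {P \<in> F. a \<notin> P}" and "F1 = {P. a \<notin> P \<and> insert a P \<in> F}"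
  have sub: "F0 \<subseteq> Pow A" "F1 \<subseteq> Pow A" using insert.prems by (auto simp: F0_def F1_def)
  then have fin: "finite F0" "finite F1" using insert.hyps by (meson finite_Pow_iff finite_subset)+
  let ?U = "shattered (F0 \<union> F1) A" and ?I = "shattered (F0 \<inter> F1) A"
  have split: "card F = card F0 + card F1" unfolding F0_def F1_def by (rule card_split_point[OF finF])
  have notin: "a \<notin> S" if "S \<in> shattered G A" for S G
    using that insert.hyps unfolding shattered_def by blast
  have "inj_on (insert a) ?I" by (rule inj_onI) (metis notin insert_ident)
  then have image: "card (insert a ` ?I) = card ?I" by (rule card_image)
  have "?U \<inter> insert a ` ?I = {}" using notin by blast
  then have union: "card (?U \<union> insert a ` ?I) = card ?U + card (insert a ` ?I)"
    using insert.hyps by (intro card_Un_disjoint) (auto simp: finite_shattered)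
  have "card (F0 \<union> F1) \<le> card ?U" "card (F0 \<inter> F1) \<le> card ?I"
    by (rule insert.IH; use sub in auto)+
  then have "card F \<le> card (?U \<union> insert a ` ?I)"
    unfolding union image split using card_Un_Int[OF fin] by linarith
  also have "\<dots> \<le> card (shattered F (insert a A))"
  proof (intro card_mono Un_least subsetI)
    fix S assume S: "S \<in> ?U"
    then have "a \<notin> S" "S \<subseteq> A" using insert.hyps unfolding shattered_def by blast+
    have "\<exists>P\<in>F. P \<inter> S = X" if X: "X \<subseteq> S" for X
    proof -
      obtain P where P: "P \<in> F0 \<union> F1" "P \<inter> S = X" using S X unfolding shattered_def by blast
      then have "P \<in> F \<or> insert a P \<in> F" by (auto simp: F0_def F1_def)
      moreover have "insert a P \<inter> S = X" using P \<open>a \<notin> S\<close> by auto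
      ultimately show ?thesis using P by blast
    qed
    then show "S \<in> shattered F (insert a A)" using \<open>S \<subseteq> A\<close> unfolding shattered_def by blast
  next
    fix S assume "S \<in> insert a ` ?I"
    then obtain S' where S': "S = insert a S'" "S' \<in> ?I" by auto
    then have "a \<notin> S'" "S' \<subseteq> A" using insert.hyps unfolding shattered_def by blast+
    have "\<exists>P\<in>F. P \<inter> S = X" if X: "X \<subseteq> S" for X
    proof -
      have "X - {a} \<subseteq> S'" using X S' by auto
      then obtain P where P: "P \<in> F0" "P \<in> F1" "P \<inter> S' = X - {a}"
        using S'(2) unfolding shattered_def by blast
      show ?thesis
      proof (cases "a \<in> X")
        case True
        then show ?thesis using P S' by (intro bexI[of _ "insert a P"]) (auto simp: F1_def)
      next
        case False
        then show ?thesis using P S' by (intro bexI[of _ P]) (auto simp: F0_def)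
      qed
    qed
    then show "S \<in> shattered F (insert a A)" using S'(1) \<open>S' \<subseteq> A\<close> unfolding shattered_def by blast
  qed (simp_all add: finite_shattered insert.hyps)
  finally show ?case .
qed

text \<open>The inclusion runs the other way here: a subcube without direction \<open>a\<close> lies
  in one half, decided by whether its background contains \<open>a\<close>, and a subcube with
  direction \<open>a\<close> leaves a copy in both halves.\<close>

lemma card_strongly_shattered_le:
  assumes "finite A" "F \<subseteq> Pow A"
  shows "card (strongly_shattered F A) \<le> card F"
  using assms
proof (induction A arbitrary: F rule: finite_induct)
  case empty
  then have "F = {} \<or> F = {{}}" by auto
  then show ?case
  proof
    assume "F = {{}}"
    then have "strongly_shattered F {} = {{}}" by (auto simp: strongly_shattered_def)
    then show ?thesis using \<open>F = {{}}\<close> by simp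
  qed (simp add: strongly_shattered_def)
next
  case (insert a A)
  have finF: "finite F" using insert by (meson finite.insertI finite_Pow_iff finite_subset)
  define F0 F1 where "F0 = {P \<in> F. a \<notin> P}" and "F1 = {P. a \<notin> P \<and> insert a P \<in> F}"
  have sub: "F0 \<subseteq> Pow A" "F1 \<subseteq> Pow A" using insert.prems by (auto simp: F0_def F1_def)
  let ?G = "strongly_shattered F (insert a A)"
  let ?M0 = "strongly_shattered F0 A" and ?M1 = "strongly_shattered F1 A"
  have "?G \<subseteq> (?M0 \<union> ?M1) \<union> insert a ` (?M0 \<inter> ?M1)"
  proof
    fix S assume "S \<in> ?G"
    then have S: "S \<subseteq> insert a A" and "\<exists>B\<subseteq>insert a A - S. \<forall>X\<subseteq>S. B \<union> X \<in> F"
      by (simp_all add: strongly_shattered_def)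
    then obtain B where B1: "B \<subseteq> insert a A - S" and B0: "\<forall>X\<subseteq>S. B \<union> X \<in> F" by blast
    have B2: "B \<union> X \<in> F" if "X \<subseteq> S" for X using B0 that by blast
    note B = B1 B2
    show "S \<in> (?M0 \<union> ?M1) \<union> insert a ` (?M0 \<inter> ?M1)"
    proof (cases "a \<in> S")
      case True
      let ?S = "S - {a}"
      have BA: "B \<subseteq> A - ?S" "a \<notin> B" and SA: "?S \<subseteq> A" using B(1) S True by auto
      have "B \<union> X \<in> F0 \<and> B \<union> X \<in> F1" if "X \<subseteq> ?S" for X
        using B(2)[of X] B(2)[of "insert a X"] that True BA by (auto simp: F0_def F1_def)
      then have "?S \<in> ?M0 \<inter> ?M1" using BA SA unfolding strongly_shattered_def by blast
      moreover have "S = insert a ?S" using True by auto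
      ultimately show ?thesis by blast
    next
      case False
      then have SA: "S \<subseteq> A" using S by auto
      show ?thesis
      proof (cases "a \<in> B")
        case True
        have "(B - {a}) \<union> X \<in> F1" if "X \<subseteq> S" for X
        proof -
          have "insert a ((B - {a}) \<union> X) = B \<union> X" using True by auto
          then show ?thesis using B(2)[OF that] False that by (auto simp: F1_def)
        qed
        moreover have "B - {a} \<subseteq> A - S" using B by auto
        ultimately have "S \<in> ?M1" using SA unfolding strongly_shattered_def by blast
        then show ?thesis by simp
      next
        case aB: False
        have "B \<union> X \<in> F0" if "X \<subseteq> S" for X
          using B(2)[OF that] aB False that by (auto simp: F0_def)
        moreover have "B \<subseteq> A - S" using B aB by auto
        ultimately have "S \<in> ?M0" using SA unfolding strongly_shattered_def by blast
        then show ?thesis by simp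
      qed
    qed
  qed
  then have "card ?G \<le> card ((?M0 \<union> ?M1) \<union> insert a ` (?M0 \<inter> ?M1))"
    using insert.hyps by (intro card_mono) (auto simp: finite_strongly_shattered)
  also have "\<dots> \<le> card (?M0 \<union> ?M1) + card (insert a ` (?M0 \<inter> ?M1))" by (rule card_Un_le)
  also have "\<dots> \<le> card (?M0 \<union> ?M1) + card (?M0 \<inter> ?M1)"
    using insert.hyps by (intro add_left_mono card_image_le) (auto simp: finite_strongly_shattered)
  also have "\<dots> = card ?M0 + card ?M1"
    using insert.hyps by (intro card_Un_Int[symmetric]) (auto simp: finite_strongly_shattered)
  also have "\<dots> \<le> card F0 + card F1" using insert.IH sub by (intro add_mono) auto
  also have "\<dots> = card F" unfolding F0_def F1_def by (rule card_split_point[OF finF, symmetric])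
  finally show ?case .
qed

text \<open>More normals than coordinates satisfy a nontrivial relation \<open>c\<close>. A point
  realising the signs of \<open>c\<close> would make every nonzero term of the vanishing sum
  \<open>c a * dot I (w a) x\<close> positive.\<close>

lemma card_shattered_sign_patterns_le:
  assumes "finite A" "finite I" "S \<in> shattered (sign_patterns I A w) A"
  shows "card S \<le> card I"
proof (rule ccontr)
  assume "\<not> card S \<le> card I"
  have SA: "S \<subseteq> A" using assms unfolding shattered_def by blast
  then have "finite S" using assms finite_subset by blast
  obtain c where c: "\<exists>a\<in>S. c a \<noteq> 0" "\<forall>i\<in>I. dot S (\<lambda>a. w a i) c = 0"
    using homogeneous_system[of I S "\<lambda>i a. w a i"] \<open>\<not> card S \<le> card I\<close> assms \<open>finite S\<close> by auto
  define X where "X = {a \<in> S. c a > 0}"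
  have "X \<subseteq> S" by (auto simp: X_def)
  then obtain P where P: "P \<in> sign_patterns I A w" "P \<inter> S = X"
    using assms(3) unfolding shattered_def by blast
  obtain x where x: "\<And>a. a \<in> P \<Longrightarrow> dot I (w a) x > 0" "\<And>a. a \<in> A - P \<Longrightarrow> dot I (w a) x < 0"
    using P(1) by (elim sign_patternsE) auto
  have "(\<Sum>a\<in>S. c a * dot I (w a) x) = dot I (\<lambda>i. \<Sum>a\<in>S. c a * w a i) x"
    by (simp add: dot_sum_left)
  also have "\<dots> = dot I (\<lambda>i. 0) x"
    using c(2) by (intro dot_cong_left) (auto simp: dot_def mult_ac)
  also have "\<dots> = 0" by (simp add: dot_def)
  finally have zero: "(\<Sum>a\<in>S. c a * dot I (w a) x) = 0" .
  have pos: "c a * dot I (w a) x > 0" if a: "a \<in> S" "c a \<noteq> 0" for a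
  proof (cases "c a > 0")
    case True
    then have "a \<in> P" using P(2) a by (auto simp: X_def)
    then show ?thesis using True x(1) by simp
  next
    case False
    then have "a \<in> A - P" using P(2) a SA by (auto simp: X_def)
    then have "dot I (w a) x < 0" by (rule x(2))
    then show ?thesis using False a by (simp add: mult_neg_neg)
  qed
  obtain a where "a \<in> S" "c a \<noteq> 0" using c by auto
  moreover have "c a * dot I (w a) x \<ge> 0" if "a \<in> S" for a using pos[OF that] by (cases "c a = 0") auto
  ultimately have "(\<Sum>a\<in>S. c a * dot I (w a) x) > 0"
    using pos \<open>finite S\<close> by (intro sum_pos2[of S a]) auto
  with zero show False by simp
qed

text \<open>For \<open>a \<in> S\<close> the condition says that \<open>S\<close> is independent, for \<open>a \<notin> S\<close> that \<open>a\<close> is not in its span.\<close>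

definition free_flat :: "'i set \<Rightarrow> 'a set \<Rightarrow> ('a \<Rightarrow> 'i \<Rightarrow> real) \<Rightarrow> 'a set \<Rightarrow> bool" where
  "free_flat I A w S \<longleftrightarrow> S \<subseteq> A \<and> (\<forall>a\<in>A. \<nexists>c. \<forall>i\<in>I. w a i = (\<Sum>b\<in>S-{a}. c b * w b i))"

text \<open>A generic point of the intersection of the hyperplanes in \<open>S\<close> lies on no
  other hyperplane and fixes the background \<open>B\<close>. Since \<open>S\<close> is independent,
  a small step from it can be given any signs on \<open>S\<close>.\<close>

lemma free_flat_strongly_shattered:
  assumes "finite A" "finite I" "free_flat I A w S"
  shows "S \<in> strongly_shattered (sign_patterns I A w) A"
proof -
  have SA: "S \<subseteq> A" using assms by (simp add: free_flat_def)
  then have fS: "finite S" using assms finite_subset by blast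
  have dual: "\<exists>x. (\<forall>b\<in>S-{a}. dot I (w b) x = 0) \<and> dot I (w a) x \<noteq> 0" if "a \<in> A" for a
    using assms that fS by (intro exists_annihilator_off_span) (auto simp: free_flat_def)
  \<comment> \<open>For \<open>a\<close> in \<open>S\<close> these vectors form a dual basis up to
    scaling; for \<open>a\<close> outside \<open>S\<close>, \<open>\<delta> a\<close> shows that the
    common zeros of \<open>S\<close> are not contained in the hyperplane of
    \<open>a\<close>.\<close>
  then obtain \<delta> where \<delta>: "\<And>a. a \<in> A \<Longrightarrow> dot I (w a) (\<delta> a) \<noteq> 0"
    "\<And>a b. a \<in> A \<Longrightarrow> b \<in> S - {a} \<Longrightarrow> dot I (w b) (\<delta> a) = 0" by metis
  let ?U = "{x. \<forall>b\<in>S. dot I (w b) x = 0}"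
  have "\<exists>y\<in>?U. \<forall>b\<in>w ` (A - S). dot I b y \<noteq> 0 \<and> (dot I b (\<lambda>_. 0) \<noteq> 0 \<longrightarrow> sgn (dot I b y) = sgn (dot I b (\<lambda>_. 0)))"
  proof (rule generic_perturbation)
    fix b assume "b \<in> w ` (A - S)"
    then obtain a where a: "a \<in> A - S" "b = w a" by auto
    then have "\<delta> a \<in> ?U" using \<delta>(2)[of a] by auto
    then show "\<exists>z\<in>?U. dot I b z \<noteq> 0" using \<delta>(1)[of a] a by auto
  qed (use assms in \<open>auto simp: dot_add_right, auto simp: dot_def\<close>)
  then obtain y where y: "\<forall>b\<in>S. dot I (w b) y = 0" "\<forall>a\<in>A-S. dot I (w a) y \<noteq> 0" by auto
  define B where "B = {a \<in> A - S. dot I (w a) y > 0}"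
  have "B \<union> X \<in> sign_patterns I A w" if X: "X \<subseteq> S" for X
  proof -
    define c where "c a = (if a \<in> X then 1 else -1) / dot I (w a) (\<delta> a)" for a
    define d where "d = (\<lambda>i. \<Sum>a\<in>S. c a * \<delta> a i)"
    have d: "dot I (w b) d = (if b \<in> X then 1 else -1)" if b: "b \<in> S" for b
    proof -
      have "dot I (w b) d = (\<Sum>a\<in>S. c a * dot I (w b) (\<delta> a))" unfolding d_def by (rule dot_sum_right)
      also have "\<dots> = (\<Sum>a\<in>S. if a = b then c b * dot I (w b) (\<delta> b) else 0)"
      proof (intro sum.cong refl)
        fix a assume "a \<in> S"
        then show "c a * dot I (w b) (\<delta> a) = (if a = b then c b * dot I (w b) (\<delta> b) else 0)"
          using \<delta>(2)[of a b] b SA by auto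
      qed
      also have "\<dots> = (if b \<in> X then 1 else -1)" using b fS \<delta>(1)[of b] SA by (auto simp: c_def)
      finally show ?thesis .
    qed
    obtain e where e: "e > 0" "\<forall>b\<in>w ` A. dot I b y \<noteq> 0 \<longrightarrow>
        sgn (dot I b (\<lambda>i. y i + e * d i)) = sgn (dot I b y)"
      using perturbation_keeps_signs[of "w ` A" I y d] assms by auto
    let ?z = "\<lambda>i. y i + e * d i"
    have zS: "dot I (w b) ?z = e * (if b \<in> X then 1 else -1)" if "b \<in> S" for b
      using that y(1) d by (simp add: dot_add_right)
    have zA: "sgn (dot I (w a) ?z) = sgn (dot I (w a) y)" if "a \<in> A - S" for a
      using e(2) y(2) that by auto
    have "dot I (w a) ?z \<noteq> 0 \<and> (0 < dot I (w a) ?z \<longleftrightarrow> a \<in> B \<union> X)" if a: "a \<in> A" for a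
    proof (cases "a \<in> S")
      case True
      then show ?thesis using zS[of a] e(1) by (auto simp: B_def)
    next
      case False
      then have aS: "a \<in> A - S" using a by simp
      have "dot I (w a) y \<noteq> 0" using y(2) aS by blast
      then show ?thesis using zA[OF aS] False X aS by (auto simp: B_def sgn_if split: if_splits)
    qed
    then show ?thesis
      by (intro sign_patternsI[of _ _ _ ?z]) (use X SA in \<open>auto simp: B_def\<close>)
  qed
  moreover have "B \<subseteq> A - S" by (auto simp: B_def)
  ultimately show ?thesis using SA unfolding strongly_shattered_def by blast
qed

subsection \<open>Antichains and the Littlewood-Offord problem\<close>

text \<open>Averaging over a deleted element \<open>i\<close>: the members avoiding \<open>i\<close>
  form an antichain in \<open>K - {i}\<close>. A member \<open>X\<close> is counted
  \<open>card (K - X)\<close> times, which the absorption identity converts into its weight for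
  \<open>K\<close>. The top set \<open>K\<close> avoids no \<open>i\<close>, but if present it is
  the only member.\<close>

lemma LYM_inequality:
  assumes "finite K" "F \<subseteq> Pow K" "\<And>X Y. X \<in> F \<Longrightarrow> Y \<in> F \<Longrightarrow> X \<subseteq> Y \<Longrightarrow> X = Y"
  shows "(\<Sum>X\<in>F. 1 / real (card K choose card X)) \<le> 1"
  using assms
proof (induction "card K" arbitrary: K F)
  case 0
  then have "F = {} \<or> F = {{}}" by auto
  then show ?case by auto
next
  case (Suc k K F)
  have finF: "finite F" using Suc.prems by (meson finite_Pow_iff finite_subset)
  have anti: "X = Y" if "X \<in> F" "Y \<in> F" "X \<subseteq> Y" for X Y using Suc.prems(3) that by blast
  show ?case
  proof (cases "K \<in> F")
    case True
    then have "F = {K}" using anti[of _ K] Suc.prems(2) by blast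
    then show ?thesis by simp
  next
    case False
    have cX: "card X \<le> k" if "X \<in> F" for X
    proof -
      have "X \<subset> K" using that False Suc.prems(2) by blast
      from psubset_card_mono[OF Suc.prems(1) this] show ?thesis using Suc.hyps(2) by linarith
    qed
    have le1: "(\<Sum>X\<in>{X \<in> F. i \<notin> X}. 1 / real (k choose card X)) \<le> 1" if "i \<in> K" for i
    proof -
      have c: "k = card (K - {i})" using Suc.hyps(2) Suc.prems(1) that by simp
      have "(\<Sum>X\<in>{X \<in> F. i \<notin> X}. 1 / real (card (K - {i}) choose card X)) \<le> 1"
      proof (rule Suc.hyps(1)[OF c])
        show "X = Y" if "X \<in> {X \<in> F. i \<notin> X}" "Y \<in> {X \<in> F. i \<notin> X}" "X \<subseteq> Y" for X Y
          using anti that by blast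
      qed (use Suc.prems in auto)
      then show ?thesis using c by simp
    qed
    have "real (Suc k) * (\<Sum>X\<in>F. 1 / real (Suc k choose card X))
        = (\<Sum>X\<in>F. real (card (K - X)) * (1 / real (k choose card X)))"
      unfolding sum_distrib_left
    proof (intro sum.cong refl)
      fix X assume X: "X \<in> F"
      have "card (K - X) = Suc k - card X"
        using X Suc.prems Suc.hyps(2) by (subst card_Diff_subset) (auto intro: finite_subset)
      moreover have "real (Suc k - card X) * real (Suc k choose card X) = real (Suc k) * real (k choose card X)"
        using binomial_absorb_comp[of "Suc k" "card X"] by (simp only: of_nat_mult[symmetric]) simp
      moreover have "real (Suc k choose card X) > 0" "real (k choose card X) > 0"
        using cX[OF X] by simp_all
      ultimately show "real (Suc k) * (1 / real (Suc k choose card X))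
          = real (card (K - X)) * (1 / real (k choose card X))"
        by (simp add: field_simps)
    qed
    also have "\<dots> = (\<Sum>X\<in>F. \<Sum>i\<in>K. if i \<notin> X then 1 / real (k choose card X) else 0)"
      using Suc.prems(1) by (intro sum.cong refl) (simp add: sum.If_cases Diff_eq Compl_eq[symmetric])
    also have "\<dots> = (\<Sum>i\<in>K. \<Sum>X\<in>F. if i \<notin> X then 1 / real (k choose card X) else 0)"
      by (rule sum.swap)
    also have "\<dots> = (\<Sum>i\<in>K. \<Sum>X\<in>{X \<in> F. i \<notin> X}. 1 / real (k choose card X))"
      using finF by (intro sum.cong refl sum.inter_filter[symmetric])
    also have "\<dots> \<le> (\<Sum>i\<in>K. 1)" by (intro sum_mono le1)
    also have "\<dots> = real (Suc k)" using Suc.hyps(2) by simp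
    finally have "real (Suc k) * (\<Sum>X\<in>F. 1 / real (Suc k choose card X)) \<le> real (Suc k)" .
    then show ?thesis unfolding Suc.hyps(2)[symmetric]
      by (metis mult_le_cancel_left_pos mult.right_neutral of_nat_0_less_iff zero_less_Suc)
  qed
qed

lemma Sperner:
  assumes "finite K" "F \<subseteq> Pow K" "\<And>X Y. X \<in> F \<Longrightarrow> Y \<in> F \<Longrightarrow> X \<subseteq> Y \<Longrightarrow> X = Y"
  shows "card F \<le> card K choose (card K div 2)"
proof -
  let ?B = "real (card K choose (card K div 2))"
  have pos: "?B > 0" by simp
  have "(\<Sum>X\<in>F. 1 / ?B) \<le> (\<Sum>X\<in>F. 1 / real (card K choose card X))"
  proof (rule sum_mono)
    fix X assume "X \<in> F"
    then have "card X \<le> card K" using assms by (auto intro: card_mono)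
    then show "1 / ?B \<le> 1 / real (card K choose card X)"
      by (intro divide_left_mono) (auto simp: binomial_maximum)
  qed
  also have "\<dots> \<le> 1" using assms by (rule LYM_inequality)
  finally have "real (card F) \<le> ?B" using pos by (simp add: field_simps)
  then show ?thesis by simp
qed

text \<open>Erdos's argument: after sign changes all coefficients are positive, the sum decreases
  strictly as the set of minus signs grows, and so its zeros form an antichain.\<close>

lemma Littlewood_Offord:
  assumes "finite K" "\<And>i. i \<in> K \<Longrightarrow> c i \<noteq> 0"
  shows "card {X. X \<subseteq> K \<and> dot K c (sign_vec X) = 0} \<le> card K choose (card K div 2)"
proof -
  define N where "N = {i \<in> K. c i < 0}"
  have sd: "sym_diff (sym_diff X N) N = X" for X by auto
  let ?a = "\<lambda>i. \<bar>c i\<bar>"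
  have eq: "dot K ?a (sign_vec (sym_diff X N)) = dot K c (sign_vec X)" for X
    unfolding dot_def by (intro sum.cong refl) (auto simp: sign_vec_def N_def)
  have "card {X. X \<subseteq> K \<and> dot K c (sign_vec X) = 0} \<le> card {Y. Y \<subseteq> K \<and> dot K ?a (sign_vec Y) = 0}"
  proof (rule card_inj_on_le[of "\<lambda>X. sym_diff X N"])
    show "inj_on (\<lambda>X. sym_diff X N) {X. X \<subseteq> K \<and> dot K c (sign_vec X) = 0}"
      by (rule inj_on_inverseI[of _ "\<lambda>X. sym_diff X N"]) (rule sd)
    show "(\<lambda>X. sym_diff X N) ` {X. X \<subseteq> K \<and> dot K c (sign_vec X) = 0}
        \<subseteq> {Y. Y \<subseteq> K \<and> dot K ?a (sign_vec Y) = 0}"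
      using eq by (auto simp: N_def)
    show "finite {Y. Y \<subseteq> K \<and> dot K ?a (sign_vec Y) = 0}"
      by (rule finite_subset[of _ "Pow K"]) (use assms in auto)
  qed
  also have "\<dots> \<le> card K choose (card K div 2)"
  proof (rule Sperner)
    fix X Y
    assume X: "X \<in> {Y. Y \<subseteq> K \<and> dot K ?a (sign_vec Y) = 0}"
      and Y: "Y \<in> {Y. Y \<subseteq> K \<and> dot K ?a (sign_vec Y) = 0}" and "X \<subseteq> Y"
    show "X = Y"
    proof (rule ccontr)
      assume "X \<noteq> Y"
      then obtain i where i: "i \<in> Y" "i \<notin> X" using \<open>X \<subseteq> Y\<close> by auto
      then have "i \<in> K" using Y by auto
      have "dot K ?a (sign_vec X) - dot K ?a (sign_vec Y) = (\<Sum>i\<in>K. ?a i * (sign_vec X i - sign_vec Y i))"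
        by (simp add: dot_def sum_subtractf right_diff_distrib)
      also have "\<dots> > 0"
      proof (rule sum_pos2[OF assms(1) \<open>i \<in> K\<close>])
        show "0 < ?a i * (sign_vec X i - sign_vec Y i)"
          using i assms(2)[OF \<open>i \<in> K\<close>] by (simp add: sign_vec_def)
        fix j
        have "sign_vec X j - sign_vec Y j \<ge> 0" using \<open>X \<subseteq> Y\<close> by (auto simp: sign_vec_def)
        then show "0 \<le> ?a j * (sign_vec X j - sign_vec Y j)" by simp
      qed
      finally show False using X Y by simp
    qed
  qed (use assms in auto)
  finally show ?thesis .
qed

section \<open>Central binomial coefficients and the Littlewood-Offord probability\<close>

lemma central_binomial_Suc:
  "Suc m * (2 * Suc m choose Suc m) = 2 * (2 * m + 1) * (2 * m choose m)"
proof -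
  have "(2 * m + 1) choose Suc m = (2 * m + 1) choose m"
    using binomial_symmetric[of m "2 * m + 1"] by simp
  then have "2 * Suc m choose Suc m = 2 * ((2 * m + 1) choose m)" by simp
  moreover have "Suc m * ((2 * m + 1) choose m) = (2 * m + 1) * (2 * m choose m)"
    using binomial_absorb_comp[of "2 * m + 1" m] by simp
  ultimately have "Suc m * (2 * Suc m choose Suc m) = 2 * ((2 * m + 1) * (2 * m choose m))"
    by (metis mult.left_commute)
  then show ?thesis by (simp only: mult.assoc)
qed

text \<open>The factor \<open>2 * m + 1\<close> is chosen so that the induction closes by
  \<open>(2 * m + 1) * (2 * m + 3) \<le> (2 * m + 2)\<^sup>2\<close>. It gives the decay of order
  \<open>1 / sqrt k\<close> below.\<close>

lemma central_binomial_square_bound: "(2 * m choose m)\<^sup>2 * (2 * m + 1) \<le> 16 ^ m"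
proof (induction m)
  case (Suc m)
  let ?b = "2 * m choose m" and ?b' = "2 * Suc m choose Suc m"
  have "(Suc m)\<^sup>2 * (?b'\<^sup>2 * (2 * Suc m + 1)) = (Suc m * ?b')\<^sup>2 * (2 * m + 3)"
  proof -
    have "2 * Suc m + 1 = 2 * m + 3" by simp
    then show ?thesis by (simp only: power_mult_distrib mult.assoc)
  qed
  also have "\<dots> = 4 * ((2 * m + 1) * (2 * m + 3)) * (?b\<^sup>2 * (2 * m + 1))"
    unfolding central_binomial_Suc by (simp add: power2_eq_square algebra_simps)
  also have "\<dots> \<le> 4 * ((2 * m + 1) * (2 * m + 3)) * 16 ^ m"
    using Suc.IH by (intro mult_left_mono) auto
  also have "\<dots> \<le> 4 * (4 * (Suc m)\<^sup>2) * 16 ^ m"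
    by (intro mult_right_mono mult_left_mono) (auto simp: power2_eq_square algebra_simps)
  also have "\<dots> = (Suc m)\<^sup>2 * 16 ^ Suc m" by simp
  finally show ?case by (simp del: binomial_Suc_Suc)
qed simp

text \<open>The quotient by \<open>4 ^ m\<close> decreases in \<open>m\<close>, and at
  \<open>m = 2\<close> it is 6/16 = 3/8.\<close>

lemma central_binomial_bound: "m \<ge> 2 \<Longrightarrow> 8 * (2 * m choose m) \<le> 3 * 4 ^ m"
proof (induction m rule: dec_induct)
  case base
  show ?case by (simp add: eval_nat_numeral)
next
  case (step m)
  have "Suc m * (8 * (2 * Suc m choose Suc m)) = 8 * (Suc m * (2 * Suc m choose Suc m))"
    by (rule mult.left_commute)
  also have "\<dots> = 2 * (2 * m + 1) * (8 * (2 * m choose m))"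
    unfolding central_binomial_Suc by (simp only: mult_ac)
  also have "\<dots> \<le> (4 * Suc m) * (3 * 4 ^ m)" by (rule mult_mono[OF _ step.IH]) auto
  also have "\<dots> = Suc m * (3 * 4 ^ Suc m)" by (simp add: algebra_simps)
  finally have "8 * (2 * Suc m choose Suc m) \<le> 3 * 4 ^ Suc m" by (simp only: Suc_mult_le_cancel1)
  then show ?case .
qed

text \<open>The Littlewood-Offord bound on the probability that a sum of \<open>k\<close> nonzero
  numbers with uniformly random signs vanishes.\<close>

definition middle_prob :: "nat \<Rightarrow> real" where
  "middle_prob k = real (k choose (k div 2)) / 2 ^ k"

lemma middle_prob_nonneg: "middle_prob k \<ge> 0"
  by (simp add: middle_prob_def)

lemma middle_prob_even: "middle_prob (2 * m) = real (2 * m choose m) / 4 ^ m"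
  by (simp add: middle_prob_def power_mult)

text \<open>Reduces estimates for odd arguments to even ones.\<close>

lemma middle_prob_odd: "middle_prob (2 * m + 1) = middle_prob (2 * Suc m)"
proof -
  have "(2 * m + 1) choose Suc m = (2 * m + 1) choose m"
    using binomial_symmetric[of m "2 * m + 1"] by simp
  then have "2 * Suc m choose Suc m = 2 * ((2 * m + 1) choose m)" by simp
  moreover have "(2 * m + 1) div 2 = m" "2 * Suc m div 2 = Suc m" by simp_all
  ultimately show ?thesis unfolding middle_prob_def by (simp del: binomial_Suc_Suc)
qed

lemma middle_prob_le_inverse_sqrt:
  assumes "k \<ge> 1"
  shows "middle_prob k \<le> 1 / sqrt (real k)"
proof -
  have ev: "middle_prob (2 * m) \<le> 1 / sqrt (real (2 * m + 1))" for m
  proof (rule power2_le_imp_le)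
    have "real ((2 * m choose m)\<^sup>2 * (2 * m + 1)) \<le> real (16 ^ m)"
      using central_binomial_square_bound[of m] by (simp only: of_nat_le_iff)
    then have "(real (2 * m choose m))\<^sup>2 * real (2 * m + 1) \<le> 16 ^ m"
      by (simp only: of_nat_mult of_nat_power of_nat_numeral)
    then have "(real (2 * m choose m))\<^sup>2 / 16 ^ m \<le> 1 / real (2 * m + 1)"
      by (simp only: pos_divide_le_eq pos_le_divide_eq times_divide_eq_left mult_1
          zero_less_power zero_less_numeral of_nat_0_less_iff add_gr_0 zero_less_one simp_thms)
    moreover have "((4::real) ^ m)\<^sup>2 = 16 ^ m"
      unfolding power2_eq_square by (simp flip: power_mult_distrib)
    ultimately show "(middle_prob (2 * m))\<^sup>2 \<le> (1 / sqrt (real (2 * m + 1)))\<^sup>2"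
      unfolding middle_prob_even power_divide by (simp only: real_sqrt_pow2 of_nat_0_le_iff power_one)
  qed simp
  show ?thesis
  proof (cases "even k")
    case True
    then obtain m where m: "k = 2 * m" by auto
    have "1 / sqrt (real (2 * m + 1)) \<le> 1 / sqrt (real k)"
      using assms m by (intro divide_left_mono) auto
    then show ?thesis using ev[of m] m by simp
  next
    case False
    then obtain m where m: "k = 2 * m + 1" by (auto elim: oddE)
    have "1 / sqrt (real (2 * Suc m + 1)) \<le> 1 / sqrt (real k)"
      using assms m by (intro divide_left_mono) auto
    then show ?thesis using ev[of "Suc m"] m middle_prob_odd[of m] by simp
  qed
qed

lemma middle_prob_le_3_8:
  assumes "k \<ge> 3"
  shows "middle_prob k \<le> 3 / 8"
proof -
  have ev: "middle_prob (2 * m) \<le> 3 / 8" if "m \<ge> 2" for m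
  proof -
    have "real (8 * (2 * m choose m)) \<le> real (3 * 4 ^ m)"
      using central_binomial_bound[OF that] by (simp only: of_nat_le_iff)
    then show ?thesis unfolding middle_prob_even by (simp add: field_simps)
  qed
  show ?thesis
  proof (cases "even k")
    case True
    then obtain m where m: "k = 2 * m" by auto
    then show ?thesis using ev[of m] assms by simp
  next
    case False
    then obtain m where m: "k = 2 * m + 1" by (auto elim: oddE)
    then show ?thesis using ev[of "Suc m"] assms middle_prob_odd[of m] by simp
  qed
qed

subsection \<open>Dependent tuples of sign vectors\<close>

text \<open>Take \<open>J\<close> of least size with the same annihilator as \<open>L\<close>. By
  minimality each \<open>j\<close> in \<open>J\<close> has a vector \<open>y j\<close> killed by all
  others in \<open>J\<close> but not by \<open>j\<close>. These vectors together with
  \<open>c\<close>, which everything kills, are independent, so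
  \<open>card J + 1 \<le> card K\<close>.\<close>

lemma exists_small_annihilating_subset:
  fixes w :: "'l \<Rightarrow> 'k \<Rightarrow> real"
  assumes "finite L" "finite K" and c: "\<exists>k\<in>K. c k \<noteq> 0" "\<And>j. j \<in> L \<Longrightarrow> dot K (w j) c = 0"
  shows "\<exists>J\<subseteq>L. card J < card K \<and>
    (\<forall>y. (\<forall>j\<in>J. dot K (w j) y = 0) \<longrightarrow> (\<forall>j\<in>L. dot K (w j) y = 0))"
proof -
  define good where "good J \<longleftrightarrow> J \<subseteq> L \<and>
    (\<forall>y. (\<forall>j\<in>J. dot K (w j) y = 0) \<longrightarrow> (\<forall>j\<in>L. dot K (w j) y = 0))" for J
  have "good L" by (simp add: good_def)
  then obtain J where J: "good J" "\<And>J'. good J' \<Longrightarrow> card J \<le> card J'"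
    using ex_has_least_nat[of good L card] by blast
  have JL: "J \<subseteq> L" using J(1) by (simp add: good_def)
  then have fJ: "finite J" using assms(1) finite_subset by blast
  have "\<exists>y. (\<forall>i\<in>J-{j}. dot K (w i) y = 0) \<and> dot K (w j) y \<noteq> 0" if j: "j \<in> J" for j
  proof -
    have "card (J - {j}) < card J" using fJ j by (rule card_Diff1_less)
    then have "\<not> good (J - {j})" using J(2)[of "J - {j}"] by linarith
    then obtain y i where y: "\<forall>i\<in>J-{j}. dot K (w i) y = 0" "i \<in> L" "dot K (w i) y \<noteq> 0"
      using JL unfolding good_def by blast
    have "\<not> (\<forall>i\<in>J. dot K (w i) y = 0)" using J(1) y(2,3) unfolding good_def by blast
    then have "dot K (w j) y \<noteq> 0" using y(1) by blast
    then show ?thesis using y(1) by blast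
  qed
  then obtain y where y: "\<And>i j. j \<in> J \<Longrightarrow> i \<in> J - {j} \<Longrightarrow> dot K (w i) (y j) = 0"
      "\<And>j. j \<in> J \<Longrightarrow> dot K (w j) (y j) \<noteq> 0" by metis
  have "card J < card K"
  proof (rule ccontr)
    assume "\<not> card J < card K"
    \<comment> \<open>\<open>None\<close> stands for \<open>c\<close> and \<open>Some j\<close> for
      \<open>y j\<close>, so that the whole family is one indexed system.\<close>
    define v where "v k o' = (case o' of None \<Rightarrow> c k | Some j \<Rightarrow> y j k)" for k o'
    have "card (insert None (Some ` J)) = Suc (card J)"
      using fJ by (simp add: card_insert_if card_image)
    then have "card K < card (insert None (Some ` J))" using \<open>\<not> card J < card K\<close> by simp
    then obtain d where d: "\<exists>i\<in>insert None (Some ` J). d i \<noteq> 0"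
        "\<forall>k\<in>K. dot (insert None (Some ` J)) (v k) d = 0"
      using homogeneous_system[of K "insert None (Some ` J)" v] assms(2) fJ by auto
    have vd: "dot (insert None (Some ` J)) (v k) d = c k * d None + (\<Sum>j\<in>J. d (Some j) * y j k)" for k
      unfolding dot_def using fJ
      by (subst sum.insert) (auto simp: v_def sum.reindex mult.commute)
    have zero: "c k * d None + (\<Sum>j\<in>J. d (Some j) * y j k) = 0" if "k \<in> K" for k
      using d(2) that vd by metis
    have dS: "d (Some i) = 0" if i: "i \<in> J" for i
    proof -
      have "0 = (\<Sum>k\<in>K. w i k * (c k * d None + (\<Sum>j\<in>J. d (Some j) * y j k)))"
        using zero by simp
      also have "\<dots> = dot K (w i) (\<lambda>k. d None * c k + 1 * (\<Sum>j\<in>J. d (Some j) * y j k))"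
        by (simp add: dot_def mult.commute)
      also have "\<dots> = d None * dot K (w i) c + (\<Sum>j\<in>J. d (Some j) * dot K (w i) (y j))"
        unfolding dot_combine_right dot_sum_right by simp
      also have "dot K (w i) c = 0" using c(2) i JL by blast
      also have "(\<Sum>j\<in>J. d (Some j) * dot K (w i) (y j)) = (\<Sum>j\<in>J. if j = i then d (Some i) * dot K (w i) (y i) else 0)"
        using y(1) i by (intro sum.cong refl) auto
      also have "\<dots> = d (Some i) * dot K (w i) (y i)" using fJ i by simp
      finally show ?thesis using y(2)[OF i] by simp
    qed
    then have "d None \<noteq> 0" using d(1) by auto
    moreover have "c k * d None = 0" if "k \<in> K" for k using zero[OF that] dS by simp
    ultimately show False using c(1) by auto
  qed
  then show ?thesis using J(1) JL unfolding good_def by blast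
qed

text \<open>The factors count the choice of \<open>k - 1\<close> determining columns, their
  arbitrary contents, and at most \<open>k choose (k div 2)\<close> possibilities for each remaining
  column.\<close>

lemma card_dependent_columns_le:
  fixes L :: "'l set" and K :: "'k set"
  assumes "finite L" "finite K" "K \<noteq> {}" "card K \<le> card L + 1"
  defines "k \<equiv> card K"
  shows "card {h \<in> L \<rightarrow>\<^sub>E Pow K. \<exists>c. (\<forall>i\<in>K. c i \<noteq> 0) \<and> (\<forall>j\<in>L. dot K c (sign_vec (h j)) = 0)}
     \<le> (card L choose (k - 1)) * ((2 ^ k) ^ (k - 1) * (k choose (k div 2)) ^ (card L - (k - 1)))"
proof -
  let ?B = "k choose (k div 2)"
  \<comment> \<open>The sign vectors in the span of the columns \<open>J\<close>, written as a
    double annihilator. The coefficient vector \<open>c\<close> has infinitely many candidates and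
    cannot be enumerated; \<open>Q\<close> depends on the columns in \<open>J\<close> alone, and
    \<open>c\<close> serves only to bound its size.\<close>
  define Q where "Q J h = {X \<in> Pow K. \<forall>y. (\<forall>i\<in>J. dot K y (sign_vec (h i)) = 0) \<longrightarrow> dot K y (sign_vec X) = 0}"
    for J and h :: "'l \<Rightarrow> 'k set"
  define G where "G J = {h \<in> L \<rightarrow>\<^sub>E Pow K. card (Q J h) \<le> ?B \<and> (\<forall>j\<in>L. h j \<in> Q J h)}" for J
  define \<J> where "\<J> = {J. J \<subseteq> L \<and> card J = k - 1}"
  have comm: "dot K a b = dot K b a" for a b by (simp add: dot_def mult.commute)
  have finQ: "finite (Q J h)" for J h
    by (rule finite_subset[of _ "Pow K"]) (use assms in \<open>auto simp: Q_def\<close>)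
  have finG: "finite (G J)" for J
    by (rule finite_subset[of _ "L \<rightarrow>\<^sub>E Pow K"]) (use assms in \<open>auto simp: G_def intro: finite_PiE\<close>)
  have finJ: "finite \<J>" by (rule finite_subset[of _ "Pow L"]) (use assms in \<open>auto simp: \<J>_def\<close>)
  have cover: "{h \<in> L \<rightarrow>\<^sub>E Pow K. \<exists>c. (\<forall>i\<in>K. c i \<noteq> 0) \<and> (\<forall>j\<in>L. dot K c (sign_vec (h j)) = 0)} \<subseteq> (\<Union>J\<in>\<J>. G J)"
  proof
    fix h assume "h \<in> {h \<in> L \<rightarrow>\<^sub>E Pow K. \<exists>c. (\<forall>i\<in>K. c i \<noteq> 0) \<and> (\<forall>j\<in>L. dot K c (sign_vec (h j)) = 0)}"
    then obtain c where h: "h \<in> L \<rightarrow>\<^sub>E Pow K" and c0: "\<forall>i\<in>K. c i \<noteq> 0"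
      "\<forall>j\<in>L. dot K c (sign_vec (h j)) = 0" by blast
    have c1: "c i \<noteq> 0" if "i \<in> K" for i using c0 that by blast
    have c2: "dot K (sign_vec (h j)) c = 0" if "j \<in> L" for j
      using c0(2) that comm[of c "sign_vec (h j)"] by metis
    note c = c1 c2
    have "\<exists>i\<in>K. c i \<noteq> 0" using c(1) assms(3) by blast
    then obtain J where J: "J \<subseteq> L" "card J < card K"
      "\<forall>y. (\<forall>j\<in>J. dot K (sign_vec (h j)) y = 0) \<longrightarrow> (\<forall>j\<in>L. dot K (sign_vec (h j)) y = 0)"
      using exists_small_annihilating_subset[of L K c "\<lambda>j. sign_vec (h j)"] assms(1,2) c(2) by blast
    \<comment> \<open>Padding \<open>J\<close> to exactly \<open>k - 1\<close> columns makes the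
      count uniform; \<open>card K \<le> card L + 1\<close> provides the room.\<close>
    have "card J \<le> k - 1" "k - 1 \<le> card L" using J(2) assms(4) by (auto simp: k_def)
    then obtain J' where J': "J \<subseteq> J'" "J' \<subseteq> L" "card J' = k - 1"
      using exists_subset_between[of J "k - 1" L] J(1) assms(1) by blast
    have "h j \<in> Q J' h" if "j \<in> L" for j
    proof -
      have "h j \<in> Pow K" using h that by auto
      moreover have "dot K y (sign_vec (h j)) = 0" if y: "\<forall>i\<in>J'. dot K y (sign_vec (h i)) = 0" for y
      proof -
        have "\<forall>i\<in>J. dot K (sign_vec (h i)) y = 0" using y J'(1) comm by (metis subset_iff)
        then show ?thesis using J(3) \<open>j \<in> L\<close> comm by metis
      qed
      ultimately show ?thesis by (simp add: Q_def)
    qed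
    moreover have "card (Q J' h) \<le> ?B"
    proof -
      have "Q J' h \<subseteq> {X. X \<subseteq> K \<and> dot K c (sign_vec X) = 0}"
      proof -
        have "\<forall>i\<in>J'. dot K c (sign_vec (h i)) = 0" using c0(2) J'(2) by blast
        then show ?thesis unfolding Q_def by blast
      qed
      then have "card (Q J' h) \<le> card {X. X \<subseteq> K \<and> dot K c (sign_vec X) = 0}"
        by (rule card_mono[rotated]) (rule finite_subset[of _ "Pow K"]; use assms(2) in auto)
      also have "\<dots> \<le> ?B" unfolding k_def by (rule Littlewood_Offord[OF assms(2) c(1)])
      finally show ?thesis .
    qed
    ultimately show "h \<in> (\<Union>J\<in>\<J>. G J)" using h J' by (auto simp: G_def \<J>_def)
  qed
  have G: "card (G J) \<le> (2 ^ k) ^ (k - 1) * ?B ^ (card L - (k - 1))" if "J \<in> \<J>" for J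
  proof -
    have J: "J \<subseteq> L" "card J = k - 1" using that by (auto simp: \<J>_def)
    then have fJ: "finite J" using assms(1) finite_subset by blast
    \<comment> \<open>The possible completions of given columns \<open>\<phi>\<close> on
      \<open>J\<close>. Contents whose span holds too many sign vectors do not arise from
      \<open>G J\<close> and get the empty set.\<close>
    define H where "H \<phi> = (if card (Q J \<phi>) \<le> ?B then (L - J) \<rightarrow>\<^sub>E Q J \<phi> else {})" for \<phi>
    have QJ: "Q J (restrict h J) = Q J h" for h by (simp add: Q_def)
    have finH: "finite (H \<phi>)" for \<phi> using finQ assms(1) by (auto simp: H_def intro!: finite_PiE)
    have cH: "card (H \<phi>) \<le> ?B ^ (card L - (k - 1))" for \<phi>
    proof (cases "card (Q J \<phi>) \<le> ?B")
      case True
      have "card ((L - J) \<rightarrow>\<^sub>E Q J \<phi>) = card (Q J \<phi>) ^ card (L - J)"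
        using assms(1) by (simp add: card_PiE)
      also have "\<dots> \<le> ?B ^ card (L - J)" using True by (rule power_mono) simp
      finally show ?thesis using J fJ True by (simp add: H_def card_Diff_subset)
    qed (simp add: H_def)
    have "card (G J) \<le> card (Sigma (J \<rightarrow>\<^sub>E Pow K) H)"
    proof (rule card_inj_on_le[of "\<lambda>h. (restrict h J, restrict h (L - J))"])
      show "inj_on (\<lambda>h. (restrict h J, restrict h (L - J))) (G J)"
      proof (rule inj_onI)
        fix g h assume gh: "g \<in> G J" "h \<in> G J"
          and eq: "(restrict g J, restrict g (L - J)) = (restrict h J, restrict h (L - J))"
        show "g = h"
        proof (rule PiE_ext[of g L "\<lambda>_. Pow K" h])
          fix x assume "x \<in> L"
          then show "g x = h x" using eq by (metis DiffI prod.inject restrict_apply')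
        qed (use gh in \<open>auto simp: G_def\<close>)
      qed
      show "(\<lambda>h. (restrict h J, restrict h (L - J))) ` G J \<subseteq> Sigma (J \<rightarrow>\<^sub>E Pow K) H"
      proof (rule image_subsetI)
        fix h assume h: "h \<in> G J"
        then have "h x \<in> Pow K" if "x \<in> L" for x using that unfolding G_def by (blast dest: PiE_mem)
        then show "(restrict h J, restrict h (L - J)) \<in> Sigma (J \<rightarrow>\<^sub>E Pow K) H"
          using h J(1) by (auto simp: H_def QJ restrict_PiE_iff, auto simp: G_def)
      qed
      show "finite (Sigma (J \<rightarrow>\<^sub>E Pow K) H)"
        using finH fJ assms(2) by (intro finite_SigmaI finite_PiE) auto
    qed
    also have "\<dots> = (\<Sum>\<phi>\<in>J \<rightarrow>\<^sub>E Pow K. card (H \<phi>))"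
      using finH fJ assms(2) by (intro card_SigmaI finite_PiE) auto
    also have "\<dots> \<le> (\<Sum>\<phi>\<in>J \<rightarrow>\<^sub>E Pow K. ?B ^ (card L - (k - 1)))" by (intro sum_mono cH)
    also have "\<dots> = (2 ^ k) ^ (k - 1) * ?B ^ (card L - (k - 1))"
      using fJ J assms(2) by (simp add: card_PiE card_Pow k_def)
    finally show ?thesis .
  qed
  have "card {h \<in> L \<rightarrow>\<^sub>E Pow K. \<exists>c. (\<forall>i\<in>K. c i \<noteq> 0) \<and> (\<forall>j\<in>L. dot K c (sign_vec (h j)) = 0)}
      \<le> card (\<Union>J\<in>\<J>. G J)"
    by (rule card_mono[OF _ cover]) (use finJ finG in auto)
  also have "\<dots> \<le> (\<Sum>J\<in>\<J>. card (G J))" by (rule card_UN_le[OF finJ])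
  also have "\<dots> \<le> (\<Sum>J\<in>\<J>. (2 ^ k) ^ (k - 1) * ?B ^ (card L - (k - 1)))" by (intro sum_mono G)
  also have "\<dots> = (card L choose (k - 1)) * ((2 ^ k) ^ (k - 1) * ?B ^ (card L - (k - 1)))"
    using n_subsets[OF assms(1), of "k - 1"] by (simp add: \<J>_def)
  finally show ?thesis .
qed

text \<open>Transposition of the sign matrix: a relation among the rows says that \<open>c\<close>
  is orthogonal to every column.\<close>

lemma card_dependent_rows_le:
  fixes L :: "'l set" and K :: "'k set"
  assumes "finite L" "finite K" "K \<noteq> {}" "card K \<le> card L + 1"
  defines "k \<equiv> card K"
  shows "card {g \<in> K \<rightarrow>\<^sub>E Pow L. \<exists>c. (\<forall>i\<in>K. c i \<noteq> 0) \<and> (\<forall>j\<in>L. (\<Sum>i\<in>K. c i * sign_vec (g i) j) = 0)}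
     \<le> (card L choose (k - 1)) * ((2 ^ k) ^ (k - 1) * (k choose (k div 2)) ^ (card L - (k - 1)))"
    (is "card ?R \<le> _")
proof -
  define tr where "tr g = (\<lambda>j\<in>L. {i \<in> K. j \<in> g i})" for g :: "'k \<Rightarrow> 'l set"
  have sv: "sign_vec (tr g j) i = sign_vec (g i) j" if "i \<in> K" "j \<in> L" for g i j
    using that by (simp add: tr_def sign_vec_def)
  have "card ?R \<le> card {h \<in> L \<rightarrow>\<^sub>E Pow K. \<exists>c. (\<forall>i\<in>K. c i \<noteq> 0) \<and> (\<forall>j\<in>L. dot K c (sign_vec (h j)) = 0)}"
    (is "_ \<le> card ?C")
  proof (rule card_inj_on_le[of tr])
    show "inj_on tr ?R"
    proof (rule inj_onI)
      fix g h assume gh: "g \<in> ?R" "h \<in> ?R" and eq: "tr g = tr h"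
      show "g = h"
      proof (rule PiE_ext[of g K "\<lambda>_. Pow L" h])
        fix i assume i: "i \<in> K"
        have "j \<in> g i \<longleftrightarrow> j \<in> h i" if "j \<in> L" for j
        proof -
          have "i \<in> tr g j \<longleftrightarrow> i \<in> tr h j" by (simp only: eq)
          then show ?thesis using i that by (simp add: tr_def)
        qed
        moreover have "g \<in> K \<rightarrow>\<^sub>E Pow L" "h \<in> K \<rightarrow>\<^sub>E Pow L" using gh by simp_all
        then have "g i \<subseteq> L" "h i \<subseteq> L" using i by (blast dest: PiE_mem)+
        ultimately show "g i = h i" by blast
      qed (use gh in simp_all)
    qed
    show "tr ` ?R \<subseteq> ?C"
    proof (intro image_subsetI CollectI conjI)
      fix g assume g: "g \<in> ?R"
      show "tr g \<in> L \<rightarrow>\<^sub>E Pow K" by (auto simp: tr_def)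
      obtain c where c: "\<forall>i\<in>K. c i \<noteq> 0" "\<forall>j\<in>L. (\<Sum>i\<in>K. c i * sign_vec (g i) j) = 0" using g by blast
      have "dot K c (sign_vec (tr g j)) = 0" if "j \<in> L" for j
        using c(2) that by (simp add: dot_def sv cong: sum.cong)
      then show "\<exists>c. (\<forall>i\<in>K. c i \<noteq> 0) \<and> (\<forall>j\<in>L. dot K c (sign_vec (tr g j)) = 0)" using c(1) by blast
    qed
    show "finite ?C"
      by (rule finite_subset[of _ "L \<rightarrow>\<^sub>E Pow K"]) (use assms(1,2) in \<open>auto intro: finite_PiE\<close>)
  qed
  also have "\<dots> \<le> (card L choose (k - 1)) * ((2 ^ k) ^ (k - 1) * (k choose (k div 2)) ^ (card L - (k - 1)))"
    unfolding k_def by (rule card_dependent_columns_le[OF assms(1-4)])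
  finally show ?thesis .
qed

section \<open>Union bound for tuples of normals that are not free flats\<close>

lemma card_restrict_mem_le:
  assumes "finite L" "finite A" "K \<subseteq> L" "D \<subseteq> K \<rightarrow>\<^sub>E A"
  shows "card {g \<in> L \<rightarrow>\<^sub>E A. restrict g K \<in> D} \<le> card D * card A ^ (card L - card K)"
proof -
  have fK: "finite K" using assms finite_subset by blast
  have fD: "finite D" using finite_subset[OF assms(4)] fK assms(2) by (simp add: finite_PiE)
  have fR: "finite ((L - K) \<rightarrow>\<^sub>E A)" using assms by (simp add: finite_PiE)
  have "card {g \<in> L \<rightarrow>\<^sub>E A. restrict g K \<in> D} \<le> card (D \<times> ((L - K) \<rightarrow>\<^sub>E A))"
  proof (rule card_inj_on_le[of "\<lambda>h. (restrict h K, restrict h (L - K))"])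
    show "inj_on (\<lambda>h. (restrict h K, restrict h (L - K))) {g \<in> L \<rightarrow>\<^sub>E A. restrict g K \<in> D}"
    proof (rule inj_onI)
      fix g h assume gh: "g \<in> {g \<in> L \<rightarrow>\<^sub>E A. restrict g K \<in> D}" "h \<in> {g \<in> L \<rightarrow>\<^sub>E A. restrict g K \<in> D}"
        and eq: "(restrict g K, restrict g (L - K)) = (restrict h K, restrict h (L - K))"
      show "g = h"
      proof (rule PiE_ext[of g L "\<lambda>_. A" h])
        fix x assume "x \<in> L"
        then show "g x = h x" using eq by (metis DiffI prod.inject restrict_apply')
      qed (use gh in auto)
    qed
    show "(\<lambda>h. (restrict h K, restrict h (L - K))) ` {g \<in> L \<rightarrow>\<^sub>E A. restrict g K \<in> D} \<subseteq> D \<times> ((L - K) \<rightarrow>\<^sub>E A)"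
      by (auto simp: restrict_PiE_iff dest: PiE_mem)
  qed (use fD fR in simp)
  also have "\<dots> = card D * card A ^ (card L - card K)"
    using assms fK by (simp add: card_cartesian_product card_PiE card_Diff_subset)
  finally show ?thesis .
qed

text \<open>Only the coordinates below \<open>n\<close> are kept, where the normals are arbitrary
  sign vectors; coordinate \<open>n\<close> is 1 for all of them.\<close>

definition dependent_rows :: "nat \<Rightarrow> nat set \<Rightarrow> (nat \<Rightarrow> nat set) set" where
  "dependent_rows n K = {g \<in> K \<rightarrow>\<^sub>E Pow {..<n}.
     \<exists>c. (\<forall>i\<in>K. c i \<noteq> 0) \<and> (\<forall>j\<in>{..<n}. (\<Sum>i\<in>K. c i * sign_vec (g i) j) = 0)}"

text \<open>Expand the offending normal in the tuple and keep only the nonzero coefficients.  All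
  normals have last coordinate 1, so at least two terms remain.\<close>

lemma not_free_flat_dependent_rows:
  assumes f: "f \<in> {..<p} \<rightarrow>\<^sub>E Pow {..<n}" and inj: "inj_on f {..<p}"
    and nff: "\<not> free_flat {..n} (Pow {..<n}) sign_vec (f ` {..<p})"
  shows "\<exists>I\<subseteq>{..<p}. 2 \<le> card I \<and> (\<exists>g\<in>{..p} \<rightarrow>\<^sub>E Pow {..<n}.
     restrict g {..<p} = f \<and> restrict g (insert p I) \<in> dependent_rows n (insert p I))"
proof -
  let ?S = "f ` {..<p}"
  have fA: "f m \<subseteq> {..<n}" if "m < p" for m using f that by (auto dest: PiE_mem)
  then have "?S \<subseteq> Pow {..<n}" by auto
  then obtain a c where a: "a \<subseteq> {..<n}" and c: "\<forall>i\<in>{..n}. sign_vec a i = (\<Sum>b\<in>?S-{a}. c b * sign_vec b i)"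
    using nff unfolding free_flat_def by blast
  define I where "I = {m. m < p \<and> f m \<noteq> a \<and> c (f m) \<noteq> 0}"
  have finI: "finite I" by (simp add: I_def)
  have exp: "sign_vec a i = (\<Sum>m\<in>I. c (f m) * sign_vec (f m) i)" if "i \<le> n" for i
  proof -
    have "?S - {a} = f ` {m. m < p \<and> f m \<noteq> a}" by auto
    then have "sign_vec a i = (\<Sum>b\<in>f ` {m. m < p \<and> f m \<noteq> a}. c b * sign_vec b i)"
      using c that by simp
    also have "\<dots> = (\<Sum>m\<in>{m. m < p \<and> f m \<noteq> a}. c (f m) * sign_vec (f m) i)"
      by (subst sum.reindex) (auto intro: inj_on_subset[OF inj])
    also have "\<dots> = (\<Sum>m\<in>I. c (f m) * sign_vec (f m) i)"
      by (intro sum.mono_neutral_right) (auto simp: I_def)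
    finally show ?thesis .
  qed
  have last: "sign_vec S n = 1" if "S \<subseteq> {..<n}" for S using that by (auto simp: sign_vec_def)
  have sumc: "(\<Sum>m\<in>I. c (f m)) = 1"
    using exp[of n] last a fA by (simp add: I_def)
  have "card I \<noteq> 0" using sumc finI by auto
  moreover have "card I \<noteq> 1"
  proof
    assume "card I = 1"
    then obtain m where m: "I = {m}" by (auto simp: card_1_singleton_iff)
    then have "c (f m) = 1" using sumc by simp
    then have eq: "sign_vec a i = sign_vec (f m) i" if "i \<le> n" for i using exp[OF that] m by simp
    have mp: "m < p" "f m \<noteq> a" using m by (auto simp: I_def)
    have "i \<in> a \<longleftrightarrow> i \<in> f m" if "i < n" for i
      using eq[of i] that by (auto simp: sign_vec_def split: if_splits)
    then have "a = f m" using a fA[OF mp(1)] by blast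
    with mp show False by simp
  qed
  ultimately have card: "2 \<le> card I" by linarith
  \<comment> \<open>Position \<open>p\<close> receives the offending normal, with coefficient -1. If
    \<open>a\<close> also occurs in the tuple, its position there is not in
    \<open>I\<close>.\<close>
  define g where "g = f(p := a)"
  define d where "d = (\<lambda>m. c (f m))(p := -1)"
  have IK: "I \<subseteq> {..<p}" "p \<notin> I" by (auto simp: I_def)
  have g: "g \<in> {..p} \<rightarrow>\<^sub>E Pow {..<n}"
  proof (rule PiE_I)
    fix x assume "x \<in> {..p}"
    then show "g x \<in> Pow {..<n}" using a fA by (cases "x = p") (auto simp: g_def)
  next
    fix x assume "x \<notin> {..p}"
    then show "g x = undefined" using f by (auto simp: g_def PiE_def extensional_def)
  qed
  have "restrict g {..<p} = f"
    using f by (auto simp: g_def PiE_def extensional_def restrict_def fun_eq_iff)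
  moreover have "restrict g (insert p I) \<in> dependent_rows n (insert p I)"
  proof -
    have "insert p I \<subseteq> {..p}" using IK(1) by auto
    then have "restrict g (insert p I) \<in> insert p I \<rightarrow>\<^sub>E Pow {..<n}"
      unfolding restrict_PiE_iff using PiE_mem[OF g] by blast
    moreover have "\<forall>i\<in>insert p I. d i \<noteq> 0" using IK(2) by (auto simp: d_def I_def)
    moreover have "\<forall>j\<in>{..<n}. (\<Sum>i\<in>insert p I. d i * sign_vec (restrict g (insert p I) i) j) = 0"
    proof
      fix j assume "j \<in> {..<n}"
      have "(\<Sum>i\<in>I. d i * sign_vec (restrict g (insert p I) i) j) = (\<Sum>m\<in>I. c (f m) * sign_vec (f m) j)"
        using IK by (intro sum.cong refl) (auto simp: d_def g_def)
      then show "(\<Sum>i\<in>insert p I. d i * sign_vec (restrict g (insert p I) i) j) = 0"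
        using IK finI exp[of j] \<open>j \<in> {..<n}\<close> by (simp add: d_def g_def)
    qed
    ultimately show ?thesis unfolding dependent_rows_def by blast
  qed
  ultimately show ?thesis using IK(1) card g by blast
qed

lemma card_noninjective_le:
  assumes "finite A"
  shows "card {f \<in> {..<p} \<rightarrow>\<^sub>E A. \<not> inj_on f {..<p}} \<le> p * p * card A ^ (p - 1)"
proof -
  let ?E = "\<lambda>i j. {f \<in> {..<p} \<rightarrow>\<^sub>E A. f i = f j}"
  have E: "card (?E i j) \<le> card A ^ (p - 1)" if ij: "i < p" "j < p" "i \<noteq> j" for i j
  proof -
    have "card (?E i j) \<le> card (({..<p} - {i}) \<rightarrow>\<^sub>E A)"
    proof (rule card_inj_on_le[of "\<lambda>f. restrict f ({..<p} - {i})"])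
      show "inj_on (\<lambda>f. restrict f ({..<p} - {i})) (?E i j)"
      proof (rule inj_onI)
        fix f g assume fg: "f \<in> ?E i j" "g \<in> ?E i j"
          and eq: "restrict f ({..<p} - {i}) = restrict g ({..<p} - {i})"
        have *: "f x = g x" if "x < p" "x \<noteq> i" for x
          using fun_cong[OF eq, of x] that by (simp add: restrict_def)
        show "f = g"
        proof (rule PiE_ext[of f "{..<p}" "\<lambda>_. A" g])
          fix x assume "x \<in> {..<p}"
          then show "f x = g x" using *[of x] *[of j] ij fg by (cases "x = i") simp_all
        qed (use fg in simp_all)
      qed
      show "(\<lambda>f. restrict f ({..<p} - {i})) ` ?E i j \<subseteq> ({..<p} - {i}) \<rightarrow>\<^sub>E A"
      proof (rule image_subsetI)
        fix f assume "f \<in> ?E i j"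
        then have f: "f \<in> {..<p} \<rightarrow>\<^sub>E A" by simp
        show "restrict f ({..<p} - {i}) \<in> ({..<p} - {i}) \<rightarrow>\<^sub>E A"
          unfolding restrict_PiE_iff using PiE_mem[OF f] by blast
      qed
    qed (use assms in \<open>simp add: finite_PiE\<close>)
    then show ?thesis using assms ij by (simp add: card_PiE)
  qed
  let ?P = "{(i, j). i < p \<and> j < p \<and> i \<noteq> j}"
  have P: "?P \<subseteq> {..<p} \<times> {..<p}" by auto
  then have finP: "finite ?P" by (rule finite_subset) simp
  have "{f \<in> {..<p} \<rightarrow>\<^sub>E A. \<not> inj_on f {..<p}} \<subseteq> (\<Union>(i, j)\<in>?P. ?E i j)"
    by (auto simp: inj_on_def)
  then have "card {f \<in> {..<p} \<rightarrow>\<^sub>E A. \<not> inj_on f {..<p}} \<le> card (\<Union>(i, j)\<in>?P. ?E i j)"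
    by (rule card_mono[rotated]) (use finP assms in \<open>auto simp: finite_PiE\<close>)
  also have "\<dots> \<le> (\<Sum>(i, j)\<in>?P. card (?E i j))"
    using card_UN_le[OF finP, of "\<lambda>(i, j). ?E i j"] by (simp add: case_prod_unfold)
  also have "\<dots> \<le> (\<Sum>(i, j)\<in>?P. card A ^ (p - 1))"
    using E by (intro sum_mono) auto
  also have "\<dots> = card ?P * card A ^ (p - 1)" by (simp add: case_prod_unfold)
  also have "\<dots> \<le> p * p * card A ^ (p - 1)"
    using card_mono[OF _ P] by (intro mult_right_mono) (auto simp: card_cartesian_product)
  finally show ?thesis .
qed

text \<open>Upper bound for the proportion of bad tuples. The first term is for repeated entries;
  the j-th summand is for relations between j entries and a further normal, with factors for the
  positions, the determining columns, the further normal, and the Littlewood-Offord probability of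
  each remaining column.\<close>

definition tuple_error :: "nat \<Rightarrow> nat \<Rightarrow> real" where
  "tuple_error n p = real (p * p) / 2 ^ n +
     (\<Sum>j=2..p. real (p choose j) * (real (n choose j) * (2 ^ n * middle_prob (j + 1) ^ (n - j))))"

lemma card_bad_tuples_le:
  assumes "1 \<le> p" "p \<le> n"
  shows "real (card {f \<in> {..<p} \<rightarrow>\<^sub>E Pow {..<n}.
      \<not> (inj_on f {..<p} \<and> free_flat {..n} (Pow {..<n}) sign_vec (f ` {..<p}))})
    \<le> tuple_error n p * (2 ^ n) ^ p"
proof -
  let ?A = "Pow {..<n}"
  have cA: "card ?A = 2 ^ n" by (simp add: card_Pow)
  define \<I> where "\<I> = {I. I \<subseteq> {..<p} \<and> 2 \<le> card I}"
  \<comment> \<open>Tuples extended by the offending normal at position \<open>p\<close>. Counting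
    these instead of their restrictions produces the additional factor \<open>2 ^ n\<close>.\<close>
  define H where "H I = {g \<in> {..p} \<rightarrow>\<^sub>E ?A. restrict g (insert p I) \<in> dependent_rows n (insert p I)}" for I
  define F where "F j = (n choose j) * ((2 ^ (j + 1)) ^ j * ((j + 1) choose ((j + 1) div 2)) ^ (n - j)) * (2 ^ n) ^ (p - j)" for j
  have finI: "finite \<I>" by (rule finite_subset[of _ "Pow {..<p}"]) (auto simp: \<I>_def)
  have finH: "finite (H I)" for I
    by (rule finite_subset[of _ "{..p} \<rightarrow>\<^sub>E ?A"]) (auto simp: H_def finite_PiE)
  have H: "card (H I) \<le> F (card I)" if "I \<in> \<I>" for I
  proof -
    have I: "I \<subseteq> {..<p}" "p \<notin> I" "finite I" using that by (auto simp: \<I>_def intro: finite_subset)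
    have cI: "card (insert p I) = card I + 1" using I by simp
    have "card I \<le> p" using card_mono[OF _ I(1)] by simp
    have "card (dependent_rows n (insert p I)) \<le> (card {..<n} choose (card (insert p I) - 1)) *
       ((2 ^ card (insert p I)) ^ (card (insert p I) - 1) *
         (card (insert p I) choose (card (insert p I) div 2)) ^ (card {..<n} - (card (insert p I) - 1)))"
      unfolding dependent_rows_def
      by (rule card_dependent_rows_le) (use I cI \<open>card I \<le> p\<close> assms in auto)
    then have dr: "card (dependent_rows n (insert p I)) \<le> (n choose card I) *
       ((2 ^ (card I + 1)) ^ card I * ((card I + 1) choose ((card I + 1) div 2)) ^ (n - card I))"
      unfolding cI by simp
    have "card (H I) \<le> card (dependent_rows n (insert p I)) * card ?A ^ (card {..p} - card (insert p I))"
      unfolding H_def by (rule card_restrict_mem_le) (use I in \<open>auto simp: dependent_rows_def\<close>)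
    also have "\<dots> \<le> F (card I)"
      unfolding F_def cA cI by (rule mult_mono[OF dr]) auto
    finally show ?thesis .
  qed
  have "{f \<in> {..<p} \<rightarrow>\<^sub>E ?A. \<not> (inj_on f {..<p} \<and> free_flat {..n} ?A sign_vec (f ` {..<p}))}
    \<subseteq> {f \<in> {..<p} \<rightarrow>\<^sub>E ?A. \<not> inj_on f {..<p}} \<union> (\<Union>I\<in>\<I>. (\<lambda>g. restrict g {..<p}) ` H I)"
  proof
    fix f assume f: "f \<in> {f \<in> {..<p} \<rightarrow>\<^sub>E ?A. \<not> (inj_on f {..<p} \<and> free_flat {..n} ?A sign_vec (f ` {..<p}))}"
    show "f \<in> {f \<in> {..<p} \<rightarrow>\<^sub>E ?A. \<not> inj_on f {..<p}} \<union> (\<Union>I\<in>\<I>. (\<lambda>g. restrict g {..<p}) ` H I)"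
    proof (cases "inj_on f {..<p}")
      case False
      then show ?thesis using f by simp
    next
      case True
      then obtain I g where "I \<subseteq> {..<p}" "2 \<le> card I" "g \<in> {..p} \<rightarrow>\<^sub>E ?A"
        "restrict g {..<p} = f" "restrict g (insert p I) \<in> dependent_rows n (insert p I)"
        using not_free_flat_dependent_rows[of f p n] f by blast
      then have "I \<in> \<I>" "g \<in> H I" "f = restrict g {..<p}" by (auto simp: \<I>_def H_def)
      then show ?thesis by blast
    qed
  qed
  then have "card {f \<in> {..<p} \<rightarrow>\<^sub>E ?A. \<not> (inj_on f {..<p} \<and> free_flat {..n} ?A sign_vec (f ` {..<p}))}
    \<le> card ({f \<in> {..<p} \<rightarrow>\<^sub>E ?A. \<not> inj_on f {..<p}} \<union> (\<Union>I\<in>\<I>. (\<lambda>g. restrict g {..<p}) ` H I))"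
    by (rule card_mono[rotated]) (use finI finH in \<open>simp add: finite_PiE\<close>)
  also have "\<dots> \<le> card {f \<in> {..<p} \<rightarrow>\<^sub>E ?A. \<not> inj_on f {..<p}} + card (\<Union>I\<in>\<I>. (\<lambda>g. restrict g {..<p}) ` H I)"
    by (rule card_Un_le)
  also have "\<dots> \<le> p * p * (2 ^ n) ^ (p - 1) + (\<Sum>I\<in>\<I>. F (card I))"
  proof (rule add_mono)
    show "card {f \<in> {..<p} \<rightarrow>\<^sub>E ?A. \<not> inj_on f {..<p}} \<le> p * p * (2 ^ n) ^ (p - 1)"
      using card_noninjective_le[of ?A p] by (simp add: cA)
    have "card (\<Union>I\<in>\<I>. (\<lambda>g. restrict g {..<p}) ` H I) \<le> (\<Sum>I\<in>\<I>. card ((\<lambda>g. restrict g {..<p}) ` H I))"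
      by (rule card_UN_le[OF finI])
    also have "\<dots> \<le> (\<Sum>I\<in>\<I>. F (card I))"
      by (intro sum_mono order_trans[OF card_image_le[OF finH] H])
    finally show "card (\<Union>I\<in>\<I>. (\<lambda>g. restrict g {..<p}) ` H I) \<le> (\<Sum>I\<in>\<I>. F (card I))" .
  qed
  also have "(\<Sum>I\<in>\<I>. F (card I)) = (\<Sum>j=2..p. (p choose j) * F j)"
  proof -
    have "(\<Sum>I\<in>\<I>. F (card I)) = (\<Sum>j=2..p. \<Sum>I\<in>{I \<in> \<I>. card I = j}. F (card I))"
    proof (rule sum.group[symmetric, OF finI])
      show "card ` \<I> \<subseteq> {2..p}" using card_mono[of "{..<p}"] by (fastforce simp: \<I>_def)
    qed simp
    also have "\<dots> = (\<Sum>j=2..p. (p choose j) * F j)"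
    proof (rule sum.cong[OF refl])
      fix j assume "j \<in> {2..p}"
      then have "{I \<in> \<I>. card I = j} = {I. I \<subseteq> {..<p} \<and> card I = j}" by (auto simp: \<I>_def)
      then have "card {I \<in> \<I>. card I = j} = p choose j" using n_subsets[of "{..<p}" j] by simp
      then show "(\<Sum>I\<in>{I \<in> \<I>. card I = j}. F (card I)) = (p choose j) * F j" by simp
    qed
    finally show ?thesis .
  qed
  finally have "card {f \<in> {..<p} \<rightarrow>\<^sub>E ?A. \<not> (inj_on f {..<p} \<and> free_flat {..n} ?A sign_vec (f ` {..<p}))}
    \<le> p * p * (2 ^ n) ^ (p - 1) + (\<Sum>j=2..p. (p choose j) * F j)" .
  then have "real (card {f \<in> {..<p} \<rightarrow>\<^sub>E ?A. \<not> (inj_on f {..<p} \<and> free_flat {..n} ?A sign_vec (f ` {..<p}))})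
    \<le> real (p * p * (2 ^ n) ^ (p - 1) + (\<Sum>j=2..p. (p choose j) * F j))"
    by (simp only: of_nat_le_iff)
  also have "\<dots> = real (p * p) * (2 ^ n) ^ (p - 1) + (\<Sum>j=2..p. real (p choose j) * real (F j))"
    by simp
  also have "\<dots> = tuple_error n p * (2 ^ n) ^ p"
  proof -
    have pw: "(2 ^ n) ^ p = (2 ^ n) * ((2::real) ^ n) ^ (p - 1)"
      using assms(1) by (cases p) auto
    have "real (F j) = real (n choose j) * (2 ^ n * middle_prob (j + 1) ^ (n - j)) * (2 ^ n) ^ p"
      if "j \<in> {2..p}" for j
    proof -
      let ?q = "(2::real) ^ (j + 1)" and ?N = "(2::real) ^ n"
      have B: "real ((j + 1) choose ((j + 1) div 2)) = middle_prob (j + 1) * ?q"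
        by (simp add: middle_prob_def)
      have "?q ^ j * ?q ^ (n - j) = ?q ^ (j + (n - j))" by (rule power_add[symmetric])
      also have "j + (n - j) = n" using that assms by simp
      also have "?q ^ n = ?N ^ (j + 1)" by (simp only: power_mult[symmetric] mult.commute)
      finally have q: "?q ^ j * ?q ^ (n - j) = ?N * ?N ^ j" by simp
      have "?N ^ j * ?N ^ (p - j) = ?N ^ (j + (p - j))" by (rule power_add[symmetric])
      then have N: "?N ^ j * ?N ^ (p - j) = ?N ^ p" using that by simp
      have "real (F j) = real (n choose j) * (?q ^ j * (middle_prob (j + 1) * ?q) ^ (n - j)) * ?N ^ (p - j)"
        unfolding F_def B[symmetric] by simp
      also have "\<dots> = real (n choose j) * middle_prob (j + 1) ^ (n - j) * (?q ^ j * ?q ^ (n - j)) * ?N ^ (p - j)"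
        by (simp only: power_mult_distrib mult_ac)
      also have "\<dots> = real (n choose j) * middle_prob (j + 1) ^ (n - j) * ?N * (?N ^ j * ?N ^ (p - j))"
        unfolding q by (simp only: mult_ac)
      finally show ?thesis unfolding N by (simp only: mult_ac)
    qed
    then show ?thesis
      unfolding tuple_error_def distrib_right sum_distrib_right
      by (simp add: pw mult.assoc)
  qed
  finally show ?thesis .
qed

text \<open>At least half of the tuples are good, and a set of size \<open>p\<close> is the image of
  at most \<open>p ^ p\<close> of them; the logarithm of \<open>p ^ p\<close> is of lower order than
  \<open>n^2 / ln n\<close>.\<close>

theorem T_lower_bound:
  assumes "1 \<le> p" "p \<le> n" "tuple_error n p \<le> 1 / 2"
  shows "(2 ^ n) ^ p / 2 \<le> real (T n) * real p ^ p"
proof -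
  let ?A = "Pow {..<n}" and ?all = "{..<p} \<rightarrow>\<^sub>E Pow {..<n}"
  let ?good = "{f \<in> ?all. inj_on f {..<p} \<and> free_flat {..n} ?A sign_vec (f ` {..<p})}"
  let ?bad = "{f \<in> ?all. \<not> (inj_on f {..<p} \<and> free_flat {..n} ?A sign_vec (f ` {..<p}))}"
  let ?S = "{S \<in> strongly_shattered (sign_patterns {..n} ?A sign_vec) ?A. card S = p}"
  have fin: "finite ?all" by (simp add: finite_PiE)
  have finS: "finite ?S" using finite_strongly_shattered[of ?A] by simp
  have all: "real (card ?all) = (2 ^ n) ^ p" by (simp add: card_PiE card_Pow)
  have "?all = ?good \<union> ?bad" by blast
  then have "card ?all = card (?good \<union> ?bad)" by simp
  also have "\<dots> = card ?good + card ?bad" using fin by (intro card_Un_disjoint) auto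
  finally have split: "real (card ?all) = real (card ?good) + real (card ?bad)" by simp
  have "real (card ?bad) \<le> tuple_error n p * (2 ^ n) ^ p" by (rule card_bad_tuples_le[OF assms(1,2)])
  also have "\<dots> \<le> 1 / 2 * (2 ^ n) ^ p" by (rule mult_right_mono[OF assms(3)]) simp
  finally have lower: "(2 ^ n) ^ p / 2 \<le> real (card ?good)" using split all by linarith
  have "card ?good \<le> card ?S * p ^ p"
  proof -
    have "?good \<subseteq> (\<Union>S\<in>?S. {..<p} \<rightarrow>\<^sub>E S)"
    proof
      fix f assume f: "f \<in> ?good"
      then have "f ` {..<p} \<in> ?S"
        using free_flat_strongly_shattered[of ?A "{..n}" sign_vec "f ` {..<p}"] by (auto simp: card_image)
      moreover have "f \<in> {..<p} \<rightarrow>\<^sub>E f ` {..<p}" using f by (auto simp: PiE_def)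
      ultimately show "f \<in> (\<Union>S\<in>?S. {..<p} \<rightarrow>\<^sub>E S)" by blast
    qed
    moreover have finS': "finite S" if "S \<in> ?S" for S
      using that assms(1) by (intro card_ge_0_finite) auto
    then have "finite (\<Union>S\<in>?S. {..<p} \<rightarrow>\<^sub>E S)"
      using finS by (intro finite_UN_I) (auto simp: finite_PiE)
    ultimately have "card ?good \<le> card (\<Union>S\<in>?S. {..<p} \<rightarrow>\<^sub>E S)" by (rule card_mono[rotated])
    also have "\<dots> \<le> (\<Sum>S\<in>?S. card ({..<p} \<rightarrow>\<^sub>E S))" by (rule card_UN_le[OF finS])
    also have "\<dots> = (\<Sum>S\<in>?S. p ^ p)" using finS' by (intro sum.cong refl) (simp add: card_PiE)
    finally show ?thesis by simp
  qed
  also have "\<dots> \<le> T n * p ^ p"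
  proof (rule mult_right_mono)
    have "card ?S \<le> card (strongly_shattered (sign_patterns {..n} ?A sign_vec) ?A)"
      by (rule card_mono) (auto simp: finite_strongly_shattered)
    also have "\<dots> \<le> T n" unfolding T_eq_card_sign_patterns
      by (rule card_strongly_shattered_le[OF _ sign_patterns_subset_Pow]) simp
    finally show "card ?S \<le> T n" .
  qed simp
  finally have "real (card ?good) \<le> real (T n * p ^ p)" by (simp only: of_nat_le_iff)
  with lower show ?thesis by simp
qed

theorem T_upper_bound: "T n \<le> (\<Sum>k\<le>n + 1. 2 ^ n choose k)"
proof -
  let ?A = "Pow {..<n}" and ?F = "sign_patterns {..n} (Pow {..<n}) sign_vec"
  have "T n \<le> card (shattered ?F ?A)"
    unfolding T_eq_card_sign_patterns by (rule card_le_card_shattered[OF _ sign_patterns_subset_Pow]) simp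
  also have "\<dots> \<le> card (\<Union>k\<le>n + 1. {S. S \<subseteq> ?A \<and> card S = k})"
  proof (rule card_mono)
    have "card S \<le> n + 1" if "S \<in> shattered ?F ?A" for S
      using card_shattered_sign_patterns_le[of ?A "{..n}" S sign_vec] that by simp
    then show "shattered ?F ?A \<subseteq> (\<Union>k\<le>n + 1. {S. S \<subseteq> ?A \<and> card S = k})"
      by (auto simp: shattered_def)
  qed auto
  also have "\<dots> \<le> (\<Sum>k\<le>n + 1. card {S. S \<subseteq> ?A \<and> card S = k})" by (rule card_UN_le) simp
  also have "\<dots> = (\<Sum>k\<le>n + 1. 2 ^ n choose k)"
    by (intro sum.cong refl) (simp add: n_subsets card_Pow)
  finally show ?thesis .
qed

subsection \<open>Numerical estimates\<close>

text \<open>Since \<open>n + 1 \<le> 2 ^ (n - 1)\<close>, the bound \<open>(2 ^ n) ^ j / j!\<close>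
  for the last term dominates the earlier ones, so the sum is at most twice it. The surplus
  \<open>2 ^ (n + 1)\<close> over \<open>2 ^ n\<^sup>2\<close> is absorbed by
  \<open>(n + 1)!\<close>. Both comparisons fail at \<open>n = 2\<close>, where the sum is 15
  against 16.\<close>

lemma T_le:
  assumes "n \<ge> 2"
  shows "T n \<le> 2 ^ n\<^sup>2"
proof (cases "n = 2")
  case True
  have "T 2 \<le> (\<Sum>k\<le>3. 4 choose k)" using T_upper_bound[of 2] by simp
  also have "\<dots> \<le> 2 ^ 2\<^sup>2" by (simp add: eval_nat_numeral)
  finally show ?thesis using True by simp
next
  case False
  then have n: "n \<ge> 3" using assms by simp
  have "m + 2 \<le> 2 ^ m" if "m \<ge> 2" for m :: nat using that by (induction m rule: dec_induct) auto
  from this[of "n - 1"] have half: "n + 1 \<le> 2 ^ (n - 1)" using n by simp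
  have two: "2 * 2 ^ (n - 1) = (2 :: nat) ^ n" using n by (cases n) auto
  have "(\<Sum>k\<le>j. 2 ^ n choose k) * fact j \<le> 2 * (2 ^ n) ^ j" if "j \<le> n + 1" for j :: nat
    using that
  proof (induction j)
    case (Suc j)
    have "(\<Sum>k\<le>Suc j. 2 ^ n choose k) * fact (Suc j) =
        Suc j * ((\<Sum>k\<le>j. 2 ^ n choose k) * fact j) + (2 ^ n choose Suc j) * fact (Suc j)"
      by (simp add: algebra_simps)
    also have "\<dots> \<le> Suc j * (2 * (2 ^ n) ^ j) + (2 ^ n) ^ Suc j"
      using Suc by (intro add_mono mult_left_mono binomial_fact_pow) auto
    also have "Suc j * (2 * (2 ^ n) ^ j) \<le> 2 ^ (n - 1) * (2 * (2 ^ n) ^ j)"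
      using Suc.prems half by (intro mult_right_mono) auto
    also have "2 ^ (n - 1) * (2 * (2 ^ n) ^ j) = ((2 :: nat) ^ n) ^ Suc j"
      unfolding power_Suc two[symmetric] by (simp only: mult_ac)
    finally show ?case by simp
  qed simp
  from this[of "n + 1"] have "(\<Sum>k\<le>n + 1. 2 ^ n choose k) * fact (n + 1) \<le> 2 * (2 ^ n) ^ (n + 1)" by simp
  also have "2 * (2 ^ n) ^ (n + 1) = 2 ^ n\<^sup>2 * (2 :: nat) ^ (n + 1)"
    by (simp add: power_add power2_eq_square flip: power_mult)
  also have "(2 :: nat) ^ (n + 1) \<le> fact (n + 1)"
    using n by (induction n rule: dec_induct) (auto simp: fact_numeral intro: mult_mono)
  finally have "(\<Sum>k\<le>n + 1. 2 ^ n choose k) * fact (n + 1) \<le> 2 ^ n\<^sup>2 * fact (n + 1)" by simp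
  then have "(\<Sum>k\<le>n + 1. 2 ^ n choose k) \<le> 2 ^ n\<^sup>2" by (simp only: mult_le_cancel2 fact_gt_zero)
  with T_upper_bound[of n] show ?thesis by linarith
qed

text \<open>The threshold is the constant of the final estimate:
  \<open>n^2 - 10 * n^2 / ln n\<close> is positive only beyond it.\<close>

locale large_dimension =
  fixes n :: nat
  assumes ln_ge: "ln (real n) \<ge> 10"
begin

abbreviation "N \<equiv> real n"
abbreviation "l \<equiv> ln (real n)"

lemma N_pos: "N > 0"
  using ln_ge by (cases "n = 0") auto

lemma exp_l: "exp l = N"
  using N_pos by simp

lemma N_ge: "N \<ge> 20000 * (1 + (l - 10) + (l - 10)\<^sup>2 / 2)"
proof -
  \<comment> \<open>Here 41/32 = 1 + 1/4 + 1/32. Splitting the exponent 10 into 40 quarters keeps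
    the quadratic Taylor bound sharp enough to exceed 20000, as \<open>exp 10\<close> is about
    22026.\<close>
  have "(41 / 32 :: real) \<le> exp (1 / 4)"
    using exp_lower_Taylor_quadratic[of "1 / 4"] by (simp add: power2_eq_square)
  then have "(41 / 32 :: real) ^ 40 \<le> exp (1 / 4) ^ 40" by (intro power_mono) auto
  also have "exp (1 / 4 :: real) ^ 40 = exp 10" by (simp flip: exp_of_nat_mult)
  finally have "(20000 :: real) \<le> exp 10" by (simp add: power_divide)
  moreover have "1 + (l - 10) + (l - 10)\<^sup>2 / 2 \<le> exp (l - 10)"
    using ln_ge by (intro exp_lower_Taylor_quadratic) simp
  ultimately have "20000 * (1 + (l - 10) + (l - 10)\<^sup>2 / 2) \<le> exp 10 * exp (l - 10)"
    using ln_ge by (intro mult_mono) auto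
  also have "\<dots> = N" using exp_l by (simp flip: exp_add)
  finally show ?thesis .
qed

lemma N_ge_20000: "N \<ge> 20000" and l_le: "l \<le> N / 2000" and l_square_le: "100 * l\<^sup>2 \<le> N"
proof -
  define x where "x = l - 10"
  have l: "l = x + 10" and x: "x \<ge> 0" using ln_ge by (auto simp: x_def)
  have sq: "x\<^sup>2 \<ge> 0" by simp
  have N: "N \<ge> 20000 + 20000 * x + 10000 * x\<^sup>2" using N_ge unfolding x_def[symmetric] by simp
  show "N \<ge> 20000" using N x sq by linarith
  show "l \<le> N / 2000" unfolding l using N x sq by linarith
  have "100 * l\<^sup>2 = 100 * x\<^sup>2 + 2000 * x + 10000" unfolding l by (simp add: power2_eq_square algebra_simps)
  then show "100 * l\<^sup>2 \<le> N" using N x sq by linarith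
qed

text \<open>The number of dimensions given up. Its constant is one less than 10, leaving
  \<open>N^2 / l\<close> for the lower-order losses.\<close>

definition r :: nat where "r = nat \<lceil>9 * N / l\<rceil>"

lemma r_ge: "9 * N / l \<le> real r" and r_le: "real r \<le> 9 * N / l + 1"
proof -
  have "9 * N / l \<ge> 0" using ln_ge by simp
  then show "9 * N / l \<le> real r" "real r \<le> 9 * N / l + 1" unfolding r_def by linarith+
qed

lemma r_less: "r < n"
proof -
  have "9 * N / l \<le> 9 * N / 10" using ln_ge by (intro divide_left_mono) auto
  then have "real r < N" using r_le N_ge_20000 by linarith
  then show ?thesis by simp
qed

definition p :: nat where "p = n - r"

lemma p_bounds: "1 \<le> p" "p \<le> n"
  using r_less by (auto simp: p_def)

text \<open>For bounded \<open>j\<close> the binomials are polynomial in \<open>N\<close>, and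
  \<open>2 ^ n * (3 / 8) ^ (n - 98)\<close> decays like \<open>(3 / 4) ^ n\<close>. Beyond 98 one
  has \<open>j + 1 \<ge> 100\<close>, which the other range uses. The target is
  \<open>exp (- 2) / N\<close>, so that fewer than \<open>N\<close> terms add up to at most
  1/4.\<close>

lemma tuple_error_term_small_j:
  assumes "2 \<le> j" "j \<le> 98" "j \<le> p"
  shows "real (p choose j) * (real (n choose j) * (2 ^ n * middle_prob (j + 1) ^ (n - j))) \<le> exp (- l - 2)"
proof -
  have Np: "N ^ j \<le> N ^ 98" using N_ge_20000 assms by (intro power_increasing) auto
  have "real (p choose j) \<le> real (p ^ j)" using binomial_le_pow[OF assms(3)] by (simp only: of_nat_le_iff)
  also have "\<dots> \<le> N ^ j" using p_bounds by (simp add: power_mono)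
  finally have 1: "real (p choose j) \<le> N ^ 98" using Np by linarith
  have "j \<le> n" using assms p_bounds by simp
  then have "real (n choose j) \<le> real (n ^ j)" using binomial_le_pow by (simp only: of_nat_le_iff)
  also have "\<dots> = N ^ j" by simp
  finally have 2: "real (n choose j) \<le> N ^ 98" using Np by linarith
  have "middle_prob (j + 1) ^ (n - j) \<le> (3 / 8) ^ (n - j)"
    using assms by (intro power_mono middle_prob_le_3_8 middle_prob_nonneg) auto
  also have "\<dots> \<le> (3 / 8) ^ (n - 98)" using assms by (intro power_decreasing) auto
  finally have 3: "middle_prob (j + 1) ^ (n - j) \<le> (3 / 8) ^ (n - 98)" .
  have n98: "real (n - 98) = N - 98" using N_ge_20000 by (simp add: of_nat_diff)
  have e38: "(3 / 8 :: real) ^ (n - 98) = exp ((N - 98) * ln (3 / 8))"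
    unfolding n98[symmetric] by (subst exp_of_nat_mult) simp
  have e2: "(2 :: real) ^ n = exp (N * ln 2)" by (subst exp_of_nat_mult) simp
  have eN: "N ^ 98 = exp (98 * l)" using N_pos by (metis exp_ln exp_of_nat_mult of_nat_numeral)
  have l8: "ln (3 / 8 :: real) = ln (3 / 4) - ln 2"
    using ln_div[of "3 / 4 :: real" 2] by simp
  have l34: "ln (3 / 4 :: real) \<le> - (1 / 4)" using ln_le_minus_one[of "3 / 4 :: real"] by simp
  have l83: "- ln (3 / 8 :: real) \<le> 5 / 3"
  proof -
    have "- ln (3 / 8 :: real) = ln (8 / 3)" using ln_inverse[of "3 / 8 :: real"] by simp
    then show ?thesis using ln_le_minus_one[of "8 / 3 :: real"] by simp
  qed
  have "real (p choose j) * (real (n choose j) * (2 ^ n * middle_prob (j + 1) ^ (n - j)))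
      \<le> N ^ 98 * (N ^ 98 * (2 ^ n * (3 / 8) ^ (n - 98)))"
    using 1 2 3 by (intro mult_mono) (auto simp: middle_prob_nonneg)
  also have "\<dots> = exp (98 * l + (98 * l + (N * ln 2 + (N - 98) * ln (3 / 8))))"
    unfolding e38 e2 eN exp_add ..
  also have "\<dots> \<le> exp (- l - 2)"
  proof -
    have "N * ln 2 + (N - 98) * ln (3 / 8) = N * ln (3 / 4) + 98 * (- ln (3 / 8))"
      by (simp add: l8 algebra_simps)
    also have "\<dots> \<le> N * (- (1 / 4)) + 98 * (5 / 3)"
      using l34 l83 N_pos by (intro add_mono mult_left_mono) auto
    finally show ?thesis using l_le N_ge_20000 by simp
  qed
  finally show ?thesis .
qed

text \<open>Both binomials are bounded by \<open>2 ^ n\<close>, giving \<open>2 ^ (3 * n)\<close> in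
  all; 25/36 is an upper bound for \<open>ln 2\<close>. The gain is the inverse square root bound on
  \<open>middle_prob\<close>.\<close>

lemma tuple_error_term_le_exp:
  assumes "j \<le> p"
  shows "real (p choose j) * (real (n choose j) * (2 ^ n * middle_prob (j + 1) ^ (n - j)))
    \<le> exp (3 * N * (25 / 36) - (N - real j) * ln (real (j + 1)) / 2)"
proof -
  have "real (p choose j) \<le> real (2 ^ p)" using binomial_le_pow2 by (simp only: of_nat_le_iff)
  also have "\<dots> \<le> 2 ^ n" using p_bounds by (simp add: power_increasing)
  finally have 1: "real (p choose j) \<le> 2 ^ n" .
  have "real (n choose j) \<le> real (2 ^ n)" using binomial_le_pow2 by (simp only: of_nat_le_iff)
  then have 2: "real (n choose j) \<le> 2 ^ n" by simp
  have "ln (sqrt (real (j + 1))) = ln (real (j + 1)) / 2" by (rule ln_sqrt) simp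
  then have "1 / sqrt (real (j + 1)) = exp (- ln (real (j + 1)) / 2)"
    by (metis exp_ln exp_minus inverse_eq_divide minus_divide_left of_nat_0_less_iff real_sqrt_gt_zero zero_less_Suc Suc_eq_plus1)
  then have "middle_prob (j + 1) \<le> exp (- ln (real (j + 1)) / 2)"
    using middle_prob_le_inverse_sqrt[of "j + 1"] by simp
  then have "middle_prob (j + 1) ^ (n - j) \<le> exp (- ln (real (j + 1)) / 2) ^ (n - j)"
    by (intro power_mono middle_prob_nonneg)
  also have "\<dots> = exp (real (n - j) * (- ln (real (j + 1)) / 2))" by (rule exp_of_nat_mult[symmetric])
  also have "real (n - j) = N - real j" using assms p_bounds by (simp add: of_nat_diff)
  finally have 3: "middle_prob (j + 1) ^ (n - j) \<le> exp ((N - real j) * (- ln (real (j + 1)) / 2))" .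
  have e2: "(2 :: real) ^ n = exp (N * ln 2)" by (subst exp_of_nat_mult) simp
  have "real (p choose j) * (real (n choose j) * (2 ^ n * middle_prob (j + 1) ^ (n - j)))
     \<le> 2 ^ n * (2 ^ n * (2 ^ n * exp ((N - real j) * (- ln (real (j + 1)) / 2))))"
    using 1 2 3 by (intro mult_mono) (auto simp: middle_prob_nonneg)
  also have "\<dots> = exp (N * ln 2 + (N * ln 2 + (N * ln 2 + (N - real j) * (- ln (real (j + 1)) / 2))))"
    unfolding e2 exp_add ..
  also have "\<dots> \<le> exp (3 * N * (25 / 36) - (N - real j) * ln (real (j + 1)) / 2)"
  proof -
    have "N * ln 2 \<le> N * (25 / 36)" using ln2_le_25_over_36 N_pos by (intro mult_left_mono) auto
    then show ?thesis by simp
  qed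
  finally show ?thesis .
qed

text \<open>Beyond 98, \<open>(N - j) * ln (j + 1)\<close> is large for two reasons. Up to
  \<open>N / 16\<close> the first factor is at least \<open>15 / 16 * N\<close> and the second at
  least 4.5. Above that the logarithm is at least \<open>0.7 * l\<close>, and
  \<open>N - j \<ge> r\<close> gives \<open>9 * 0.7 = 6.3\<close>.\<close>

lemma tuple_error_term_le:
  assumes "2 \<le> j" "j \<le> p"
  shows "real (p choose j) * (real (n choose j) * (2 ^ n * middle_prob (j + 1) ^ (n - j))) \<le> exp (- l - 2)"
proof (cases "j \<le> 98")
  case True
  then show ?thesis using tuple_error_term_small_j assms by blast
next
  case False
  have jn: "real j \<le> N - real r" using assms(2) r_less by (simp add: p_def)
  have "(N - real j) * ln (real (j + 1)) \<ge> 4.2 * N"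
  proof (cases "real j \<le> N / 16")
    case True
    have "exp (9 :: real) = exp 1 ^ 9" by (simp flip: exp_of_nat_mult)
    also have "\<dots> \<le> (272 / 100) ^ 9" using e_less_272 by (intro power_mono) auto
    also have "\<dots> \<le> 100 ^ 2" by (simp add: power_divide)
    finally have "9 \<le> ln ((100 :: real) ^ 2)" by (subst ln_ge_iff) auto
    also have "ln ((100 :: real) ^ 2) = 2 * ln 100" by (subst ln_realpow) simp_all
    finally have "4.5 \<le> ln (100 :: real)" by simp
    also have "\<dots> \<le> ln (real (j + 1))" using False by (subst ln_le_cancel_iff) auto
    finally have "(15 / 16 * N) * 4.5 \<le> (N - real j) * ln (real (j + 1))"
      using True N_pos by (intro mult_mono) auto
    then show ?thesis using N_pos by linarith
  next
    case jN: False
    have "ln (16 :: real) = 4 * ln 2" using ln_realpow[of "2 :: real" 4] by simp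
    then have "l - 25 / 9 \<le> ln (N / 16)" using ln2_le_25_over_36 N_pos by (subst ln_div) auto
    also have "\<dots> \<le> ln (real (j + 1))" using jN N_pos by (subst ln_le_cancel_iff) auto
    finally have "0.7 * l \<le> ln (real (j + 1))" using ln_ge by linarith
    moreover have "9 * N / l \<le> N - real j" using jn r_ge by linarith
    ultimately have "(9 * N / l) * (0.7 * l) \<le> (N - real j) * ln (real (j + 1))"
      using ln_ge jn by (intro mult_mono) auto
    moreover have "(9 * N / x) * (0.7 * x) = 6.3 * N" if "x \<noteq> 0" for x :: real using that by simp
    from this[of l] have "(9 * N / l) * (0.7 * l) = 6.3 * N" using ln_ge by linarith
    ultimately show ?thesis using N_pos by linarith
  qed
  \<comment> \<open>Half of 4.2 exceeds 3 * 25/36 by 1/60, and \<open>N / 60\<close> covers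
    \<open>l + 2\<close>.\<close>
  then have "3 * N * (25 / 36) - (N - real j) * ln (real (j + 1)) / 2 \<le> - l - 2"
    using l_le N_ge_20000 by linarith
  then have "exp (3 * N * (25 / 36) - (N - real j) * ln (real (j + 1)) / 2) \<le> exp (- l - 2)" by simp
  with tuple_error_term_le_exp[OF assms(2)] show ?thesis by linarith
qed

lemma tuple_error_le_half: "tuple_error n p \<le> 1 / 2"
proof -
  have e2: "exp (2 :: real) \<ge> 4"
  proof -
    have "(2 :: real) \<le> exp 1" using exp_ge_add_one_self[of 1] by simp
    then have "(2 :: real) ^ 2 \<le> exp 1 ^ 2" by (intro power_mono) auto
    also have "exp (1 :: real) ^ 2 = exp 2" by (simp flip: exp_of_nat_mult)
    finally show ?thesis by simp
  qed
  have "real (p * p) \<le> N * N" using p_bounds by (simp add: mult_mono)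
  also have "4 * (N * N) \<le> exp 2 * (exp l * exp l)"
    unfolding exp_l using e2 by (intro mult_right_mono) auto
  then have "N * N \<le> exp (2 + (l + l)) / 4" unfolding exp_add by linarith
  also have "\<dots> \<le> exp (N * ln 2) / 4"
  proof -
    have "2 + (l + l) \<le> N * (2 / 3)" using l_le N_ge_20000 by linarith
    also have "\<dots> \<le> N * ln 2" using ln2_ge_two_thirds by (intro mult_left_mono) auto
    finally show ?thesis by simp
  qed
  also have "exp (N * ln 2) = 2 ^ n" by (subst exp_of_nat_mult) simp
  finally have 1: "real (p * p) / 2 ^ n \<le> 1 / 4" by (simp add: field_simps)
  have "(\<Sum>j=2..p. real (p choose j) * (real (n choose j) * (2 ^ n * middle_prob (j + 1) ^ (n - j))))
      \<le> (\<Sum>j=2..p. exp (- l - 2))"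
    by (intro sum_mono tuple_error_term_le) auto
  also have "\<dots> = real (p - 1) * exp (- l - 2)" by simp
  also have "\<dots> \<le> N * exp (- l - 2)" using p_bounds by (intro mult_right_mono) auto
  also have "\<dots> = exp (- 2)" using exp_l N_pos by (simp add: exp_diff exp_minus field_simps)
  also have "\<dots> \<le> 1 / 4" using e2 by (simp add: exp_minus field_simps)
  finally show ?thesis using 1 unfolding tuple_error_def by linarith
qed

text \<open>The counting bound gives \<open>p * N - 1 - p * log 2 p\<close>. Replacing
  \<open>p\<close> by \<open>N - r\<close> costs \<open>9 * N^2 / l + N\<close>; the factor 1.5 is
  the reciprocal of the lower bound 2/3 for \<open>ln 2\<close>.\<close>

lemma log_T_ge: "N\<^sup>2 - 10 * N\<^sup>2 / l \<le> log 2 (real (T n))"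
proof -
  have lower: "(2 ^ n) ^ p / 2 \<le> real (T n) * real p ^ p"
    using T_lower_bound[OF p_bounds tuple_error_le_half] .
  have pp: "real p ^ p > 0" using p_bounds by simp
  have "0 < (2 ^ n) ^ p / (2 :: real)" by simp
  then have "real (T n) * real p ^ p > 0" using lower by linarith
  then have Tpos: "real (T n) > 0" using pp zero_less_mult_pos2 by blast
  have "log 2 ((2 ^ n) ^ p / 2) \<le> log 2 (real (T n) * real p ^ p)" using lower by (subst log_le_cancel_iff) (auto intro: less_le_trans[OF _ lower])
  then have "real p * N - 1 \<le> log 2 (real (T n)) + real p * log 2 (real p)"
    using Tpos pp p_bounds by (simp add: log_divide log_mult log_nat_power)
  moreover have "real p * log 2 (real p) \<le> N * (1.5 * l)"
  proof (intro mult_mono)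
    have "log 2 (real p) \<le> log 2 N" using p_bounds by (subst log_le_cancel_iff) auto
    also have "\<dots> = l / ln 2" by (simp add: log_def)
    also have "\<dots> \<le> l / (2 / 3)" using ln2_ge_two_thirds ln_ge by (intro divide_left_mono) auto
    finally show "log 2 (real p) \<le> 1.5 * l" by simp
  qed (use p_bounds ln_ge in auto)
  moreover have "real p * N \<ge> N\<^sup>2 - 9 * N\<^sup>2 / l - N"
  proof -
    have "real p = N - real r" using r_less by (simp add: p_def of_nat_diff)
    then have "(N - 9 * N / l - 1) * N \<le> real p * N" using r_le by (intro mult_right_mono) auto
    then show ?thesis by (simp add: power2_eq_square algebra_simps)
  qed
  \<comment> \<open>All lower-order losses fit into the tenth \<open>N^2 / l\<close>, because
    \<open>2 * l^2 \<le> N\<close>.\<close>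
  moreover have "N + 1 + N * (1.5 * l) \<le> N\<^sup>2 / l"
  proof -
    have "2 * l\<^sup>2 \<le> N" using l_square_le zero_le_power2[of l] by linarith
    then have "N * (2 * l\<^sup>2) \<le> N * N" using N_pos by (intro mult_left_mono) auto
    then have "N * (2 * l) * l \<le> N * N" by (simp add: power2_eq_square mult.assoc)
    then have "N * (2 * l) \<le> N\<^sup>2 / l" using ln_ge by (simp add: pos_le_divide_eq power2_eq_square)
    moreover have "N * 10 \<le> N * l" using ln_ge by (intro mult_left_mono) auto
    moreover have "N * (1.5 * l) = 3 / 2 * (N * l)" "N * (2 * l) = 2 * (N * l)" by simp_all
    moreover have "N + 1 \<le> 5 * N" using N_ge_20000 by linarith
    ultimately show ?thesis by linarith
  qed
  moreover have "10 * N\<^sup>2 / l = 9 * N\<^sup>2 / l + N\<^sup>2 / l" by (simp add: add_divide_distrib[symmetric])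
  ultimately show ?thesis by linarith
qed

end

text \<open>For \<open>n < e\<^sup>1\<^sup>0\<close> the left-hand side is not positive.\<close>

lemma log_T_lower_bound:
  assumes "n \<ge> 2"
  shows "(real n)\<^sup>2 - 10 * (real n)\<^sup>2 / ln (real n) \<le> log 2 (real (T n))"
proof (cases "ln (real n) \<ge> 10")
  case True
  then interpret large_dimension n by unfold_locales
  show ?thesis by (rule log_T_ge)
next
  case False
  have "T n \<ge> 1" using R_upper_bound[OF assms] by linarith
  then have "log 2 (real (T n)) \<ge> 0" by simp
  moreover have "ln (real n) > 0" using assms by simp
  then have "(real n)\<^sup>2 * ln (real n) \<le> 10 * (real n)\<^sup>2" using False by (simp add: mult.commute mult_right_mono)
  then have "(real n)\<^sup>2 \<le> 10 * (real n)\<^sup>2 / ln (real n)"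
    using \<open>ln (real n) > 0\<close> by (simp add: pos_le_divide_eq)
  ultimately show ?thesis by linarith
qed

theorem theorem1:
  shows "(\<forall>n\<ge>2::nat. (real n + 1) / 2 ^ (n + 1) * real (T n) < real (R n) \<and>
            real (R n) < 1 / 2 * real (T n)) \<and>
         (\<forall>n\<ge>2::nat. (real n)\<^sup>2 - 10 * (real n)\<^sup>2 / ln (real n) - real n + log 2 (real n + 1) - 1
              < log 2 (real (R n)) \<and>
            log 2 (real (R n)) < (real n)\<^sup>2 - 1) \<and>
         (\<lambda>n. log 2 (real (R n)) / (real n)\<^sup>2) \<longlonglongrightarrow> 1"
proof -
  have compare: "(real n + 1) / 2 ^ (n + 1) * real (T n) < real (R n)" "real (R n) < 1 / 2 * real (T n)"
    if "n \<ge> 2" for n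
  proof -
    have "real ((n + 1) * T n) < real (2 ^ (n + 1) * R n)"
      using R_lower_bound[OF that] by (simp only: of_nat_less_iff)
    then show "(real n + 1) / 2 ^ (n + 1) * real (T n) < real (R n)" by (simp add: field_simps)
    have "real (2 * R n) < real (T n)" using R_upper_bound[OF that] by (simp only: of_nat_less_iff)
    then show "real (R n) < 1 / 2 * real (T n)" by simp
  qed
  have logs: "(real n)\<^sup>2 - 10 * (real n)\<^sup>2 / ln (real n) - real n + log 2 (real n + 1) - 1
              < log 2 (real (R n))" "log 2 (real (R n)) < (real n)\<^sup>2 - 1"
    if n: "n \<ge> 2" for n
  proof -
    have T: "real (T n) > 0" using R_upper_bound[OF n] by simp
    then have pos: "0 < (real n + 1) / 2 ^ (n + 1) * real (T n)" by simp
    have "log 2 (real n + 1) - real (n + 1) + log 2 (real (T n)) = log 2 ((real n + 1) / 2 ^ (n + 1) * real (T n))"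
      using T by (subst log_mult) (simp_all add: log_divide log_nat_power del: power_Suc)
    also have "\<dots> < log 2 (real (R n))" using compare(1)[OF n] pos by (subst log_less_cancel_iff) auto
    finally show "(real n)\<^sup>2 - 10 * (real n)\<^sup>2 / ln (real n) - real n + log 2 (real n + 1) - 1
              < log 2 (real (R n))" using log_T_lower_bound[OF n] by simp
    have R: "real (R n) > 0" using compare(1)[OF n] pos by linarith
    have "log 2 (real (R n)) < log 2 (1 / 2 * real (T n))"
      using compare(2)[OF n] R by (subst log_less_cancel_iff) auto
    also have "\<dots> = log 2 (real (T n)) - 1" using T by (subst log_mult) (auto simp: log_divide)
    also have "log 2 (real (T n)) \<le> log 2 (2 ^ n\<^sup>2)"
    proof (subst log_le_cancel_iff)
      have "real (T n) \<le> real (2 ^ n\<^sup>2)" using T_le[OF n] by (simp only: of_nat_le_iff)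
      then show "real (T n) \<le> 2 ^ n\<^sup>2" by simp
    qed (use T in auto)
    also have "\<dots> = (real n)\<^sup>2" by (simp add: log_nat_power)
    finally show "log 2 (real (R n)) < (real n)\<^sup>2 - 1" by simp
  qed
  have "(\<lambda>n. log 2 (real (R n)) / (real n)\<^sup>2) \<longlonglongrightarrow> 1"
  proof (rule tendsto_sandwich)
    show "(\<lambda>n. ((real n)\<^sup>2 - 10 * (real n)\<^sup>2 / ln (real n) - real n + log 2 (real n + 1) - 1) / (real n)\<^sup>2) \<longlonglongrightarrow> 1"
      by real_asymp
    show "(\<lambda>n. ((real n)\<^sup>2 - 1) / (real n)\<^sup>2) \<longlonglongrightarrow> 1" by real_asymp
    show "\<forall>\<^sub>F n in sequentially. ((real n)\<^sup>2 - 10 * (real n)\<^sup>2 / ln (real n) - real n + log 2 (real n + 1) - 1) / (real n)\<^sup>2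
        \<le> log 2 (real (R n)) / (real n)\<^sup>2"
      using eventually_ge_at_top[of 2] by eventually_elim (intro divide_right_mono less_imp_le[OF logs(1)], auto)
    show "\<forall>\<^sub>F n in sequentially. log 2 (real (R n)) / (real n)\<^sup>2 \<le> ((real n)\<^sup>2 - 1) / (real n)\<^sup>2"
      using eventually_ge_at_top[of 2] by eventually_elim (intro divide_right_mono less_imp_le[OF logs(2)], auto)
  qed
  with compare logs show ?thesis by blast
qed

end
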